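(* If $0\neq\zeta\in\mathbb{C}$, then $\mathrm{S}(\mathrm{Vir})/(z-\zeta)$ is Poisson simple: it has no nontrivial Poisson ideals (i.e. its only Poisson ideals are $0$ and the whole algebra).
   Context: $\mathrm{Vir}=\mathbb{C}[t,t^{-1}]\partial_t\oplus\mathbb{C}z$ is the Virasoro algebra, with $z$ central and $[f\partial_t,g\partial_t]=(fg'-f'g)\partial_t+\mathrm{Res}_0(f'g''-g'f'')z$, where $\mathrm{Res}_0$ denotes the coefficient of $t^{-1}$. The symmetric algebra $\mathrm{S}(\mathrm{Vir})$ is a Poisson algebra via the bracket extending $\{u,v\}=[u,v]$ for $u,v\in\mathrm{Vir}$; the ideal $(z-\zeta)$ generated by $z-\zeta$ is Poisson, so the quotient is a Poisson algebra. A Poisson ideal of a Poisson algebra $A$ is an ideal $I$ with $\{I,A\}\subseteq I$. *)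

theory Defs
  imports
    Complex_Main
    "HOL-Library.Poly_Mapping"
    "HOL-Library.Product_Plus"
    "HOL-Algebra.QuotRing"
    "HOL-Algebra.Module"
    "HOL-Algebra.Algebraic_Closure_Type"
begin

section \<open>Poisson algebras\<close>

record ('a, 'b) poisson = "('a, 'b) module" +
  pbracket :: "'b \<Rightarrow> 'b \<Rightarrow> 'b"

locale poisson_algebra = algebra R A for R (structure) and A :: "('a, 'b, 'm) poisson_scheme" (structure) +
  assumes pbracket_closed [simp]:
      "\<lbrakk>x \<in> carrier A; y \<in> carrier A\<rbrakk> \<Longrightarrow> pbracket A x y \<in> carrier A"
    and pbracket_add:
      "\<lbrakk>x \<in> carrier A; y \<in> carrier A; w \<in> carrier A\<rbrakk> \<Longrightarrow>
        pbracket A (x \<oplus>\<^bsub>A\<^esub> y) w = pbracket A x w \<oplus>\<^bsub>A\<^esub> pbracket A y w"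
    and pbracket_smult:
      "\<lbrakk>c \<in> carrier R; x \<in> carrier A; w \<in> carrier A\<rbrakk> \<Longrightarrow>
        pbracket A (c \<odot>\<^bsub>A\<^esub> x) w = c \<odot>\<^bsub>A\<^esub> pbracket A x w"
    and pbracket_self:
      "x \<in> carrier A \<Longrightarrow> pbracket A x x = \<zero>\<^bsub>A\<^esub>"
    and pbracket_anti:
      "\<lbrakk>x \<in> carrier A; y \<in> carrier A\<rbrakk> \<Longrightarrow> pbracket A x y = \<ominus>\<^bsub>A\<^esub> pbracket A y x"
    and pbracket_jacobi:
      "\<lbrakk>x \<in> carrier A; y \<in> carrier A; w \<in> carrier A\<rbrakk> \<Longrightarrow>
        pbracket A x (pbracket A y w) \<oplus>\<^bsub>A\<^esub> pbracket A y (pbracket A w x)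
          \<oplus>\<^bsub>A\<^esub> pbracket A w (pbracket A x y) = \<zero>\<^bsub>A\<^esub>"
    and pbracket_leibniz:
      "\<lbrakk>x \<in> carrier A; y \<in> carrier A; w \<in> carrier A\<rbrakk> \<Longrightarrow>
        pbracket A (x \<otimes>\<^bsub>A\<^esub> y) w
          = x \<otimes>\<^bsub>A\<^esub> pbracket A y w \<oplus>\<^bsub>A\<^esub> pbracket A x w \<otimes>\<^bsub>A\<^esub> y"

definition poisson_ideal :: "'b set \<Rightarrow> ('a, 'b, 'm) poisson_scheme \<Rightarrow> bool" where
  "poisson_ideal I A \<longleftrightarrow>
     ideal I A \<and> (\<forall>x\<in>I. \<forall>y\<in>carrier A. pbracket A x y \<in> I)"

definition poisson_simple :: "('a, 'b, 'm) poisson_scheme \<Rightarrow> bool" where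
  "poisson_simple A \<longleftrightarrow>
     (\<forall>I. poisson_ideal I A \<longrightarrow> I = {\<zero>\<^bsub>A\<^esub>} \<or> I = carrier A)"

definition poisson_quot ::
    "('a, 'b, 'm) poisson_scheme \<Rightarrow> 'b set \<Rightarrow> ('a, 'b set) poisson" where
  "poisson_quot A I =
     \<lparr>carrier = carrier (A Quot I), monoid.mult = (\<otimes>\<^bsub>A Quot I\<^esub>),
      one = \<one>\<^bsub>A Quot I\<^esub>, ring.zero = \<zero>\<^bsub>A Quot I\<^esub>, add = (\<oplus>\<^bsub>A Quot I\<^esub>),
      module.smult = (\<lambda>c U. \<Union>x\<in>U. I +>\<^bsub>A\<^esub> (c \<odot>\<^bsub>A\<^esub> x)),
      pbracket = (\<lambda>U V. \<Union>x\<in>U. \<Union>y\<in>V. I +>\<^bsub>A\<^esub> pbracket A x y)\<rparr>"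


section \<open>The Virasoro algebra\<close>

text \<open>
  A Laurent polynomial is a finitely supported family of coefficients indexed by the
  exponents; multiplication on \<^typ>\<open>int \<Rightarrow>\<^sub>0 complex\<close> is convolution.
\<close>

type_synonym laurent = "int \<Rightarrow>\<^sub>0 complex"

definition laurent_deriv :: "laurent \<Rightarrow> laurent" where
  "laurent_deriv f =
     (\<Sum>n\<in>Poly_Mapping.keys f.
        Poly_Mapping.single (n - 1) (of_int n * Poly_Mapping.lookup f n))"

definition laurent_res :: "laurent \<Rightarrow> complex" where
  "laurent_res f = Poly_Mapping.lookup f (- 1)"

text \<open>The pair \<open>(f, c)\<close> stands for \<open>f \<partial>\<^sub>t + c z\<close>.\<close>

type_synonym vir = "laurent \<times> complex"

definition vir_scale :: "complex \<Rightarrow> vir \<Rightarrow> vir" where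
  "vir_scale a u = (Poly_Mapping.single 0 a * fst u, a * snd u)"

definition vir_bracket :: "vir \<Rightarrow> vir \<Rightarrow> vir" where
  "vir_bracket u v =
     (let f = fst u; g = fst v; f' = laurent_deriv f; g' = laurent_deriv g
      in (f * g' - f' * g,
          laurent_res (f' * laurent_deriv g' - g' * laurent_deriv f')))"


section \<open>The symmetric algebra of the Virasoro algebra\<close>

text \<open>
  The symmetric algebra of a vector space with a chosen basis is the polynomial algebra
  on that basis.  Here the basis consists of the \<open>t\<^sup>n \<partial>\<^sub>t\<close> (written \<open>Vec n\<close>, with no index
  shift) and \<open>z\<close> (written \<open>Central\<close>).  A monomial is a finitely supported exponent function.
  The universal property is \<open>symvir_universal\<close> below.
\<close>

datatype vir_basis = Vec int | Central

type_synonym symvir = "(vir_basis \<Rightarrow>\<^sub>0 nat) \<Rightarrow>\<^sub>0 complex"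

primrec vir_vec :: "vir_basis \<Rightarrow> vir" where
  "vir_vec (Vec n) = (Poly_Mapping.single n 1, 0)"
| "vir_vec Central = (0, 1)"

definition sym_const :: "complex \<Rightarrow> symvir" where
  "sym_const a = Poly_Mapping.single 0 a"

definition sym_var :: "vir_basis \<Rightarrow> symvir" where
  "sym_var b = Poly_Mapping.single (Poly_Mapping.single b 1) 1"

definition sym_incl :: "vir \<Rightarrow> symvir" where
  "sym_incl u =
     (\<Sum>n\<in>Poly_Mapping.keys (fst u).
        sym_const (Poly_Mapping.lookup (fst u) n) * sym_var (Vec n))
     + sym_const (snd u) * sym_var Central"

definition sym_pdiff :: "vir_basis \<Rightarrow> symvir \<Rightarrow> symvir" where
  "sym_pdiff b p =
     (\<Sum>m\<in>Poly_Mapping.keys p.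
        Poly_Mapping.single (m - Poly_Mapping.single b 1)
          (of_nat (Poly_Mapping.lookup m b) * Poly_Mapping.lookup p m))"

definition sym_vars :: "symvir \<Rightarrow> vir_basis set" where
  "sym_vars p = (\<Union>m\<in>Poly_Mapping.keys p. Poly_Mapping.keys m)"

text \<open>
  The coordinate formula for the bracket of \<open>S(Vir)\<close>.  By \<open>sym_bracket_incl\<close>,
  \<open>symvir_poisson_algebra\<close> and \<open>sym_bracket_unique\<close> below it is the unique Poisson bracket
  extending the Lie bracket.
\<close>

definition sym_bracket :: "symvir \<Rightarrow> symvir \<Rightarrow> symvir" where
  "sym_bracket p q =
     (\<Sum>a\<in>sym_vars p. \<Sum>b\<in>sym_vars q.
        sym_pdiff a p * sym_pdiff b q * sym_incl (vir_bracket (vir_vec a) (vir_vec b)))"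

definition S_Vir :: "(complex, symvir) poisson" where
  "S_Vir =
     \<lparr>carrier = UNIV, monoid.mult = (*), one = 1, ring.zero = 0, add = (+),
      module.smult = (\<lambda>c p. sym_const c * p), pbracket = sym_bracket\<rparr>"

definition central_ideal :: "complex \<Rightarrow> symvir set" where
  "central_ideal \<zeta> = Idl\<^bsub>S_Vir\<^esub> {sym_incl (0, 1) - sym_const \<zeta>}"


section \<open>The constructions satisfy their characterising properties\<close>

lemma pm_expand: "(p :: 'a \<Rightarrow>\<^sub>0 'b::comm_monoid_add) =
   (\<Sum>m\<in>Poly_Mapping.keys p. Poly_Mapping.single m (Poly_Mapping.lookup p m))"
  by (rule poly_mapping_eqI)
     (simp add: lookup_sum lookup_single when_def Poly_Mapping.in_keys_iff)

lemma pm_induct [case_names zero add]: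
  fixes p :: "'a \<Rightarrow>\<^sub>0 'b::comm_monoid_add"
  assumes z: "P 0" and a: "\<And>m c q. P q \<Longrightarrow> P (Poly_Mapping.single m c + q)"
  shows "P p"
proof -
  have "P (\<Sum>m\<in>K. Poly_Mapping.single m (Poly_Mapping.lookup p m))" if "finite K" for K
    using that by (induction K) (auto simp: z a)
  from this[of "Poly_Mapping.keys p"] show ?thesis
    using pm_expand[of p] by simp
qed

lemma lookup_laurent_deriv:
  "Poly_Mapping.lookup (laurent_deriv f) k = of_int (k + 1) * Poly_Mapping.lookup f (k + 1)"
proof -
  have "Poly_Mapping.lookup (laurent_deriv f) k =
    (\<Sum>n\<in>Poly_Mapping.keys f. if n = k + 1 then of_int n * Poly_Mapping.lookup f n else 0)"
    unfolding laurent_deriv_def lookup_sum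
    by (intro sum.cong) (auto simp: lookup_single when_def)
  then show ?thesis by (simp add: sum.delta Poly_Mapping.in_keys_iff)
qed

lemma laurent_deriv_add: "laurent_deriv (f + g) = laurent_deriv f + laurent_deriv g"
  by (rule poly_mapping_eqI) (simp add: lookup_laurent_deriv lookup_add algebra_simps)

lemma laurent_deriv_zero [simp]: "laurent_deriv 0 = 0"
  by (rule poly_mapping_eqI) (simp add: lookup_laurent_deriv)

lemma laurent_deriv_diff: "laurent_deriv (f - g) = laurent_deriv f - laurent_deriv g"
  by (rule poly_mapping_eqI) (simp add: lookup_laurent_deriv lookup_minus algebra_simps)

lemma laurent_deriv_single:
  "laurent_deriv (Poly_Mapping.single n c) = Poly_Mapping.single (n - 1) (of_int n * c)"
  by (rule poly_mapping_eqI) (auto simp: lookup_laurent_deriv lookup_single when_def)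

lemma laurent_deriv_mult: "laurent_deriv (f * g) = laurent_deriv f * g + f * laurent_deriv g"
proof (induction f rule: pm_induct)
  case zero
  show ?case by simp
next
  case (add m c q)
  have "laurent_deriv (Poly_Mapping.single m c * g) =
     laurent_deriv (Poly_Mapping.single m c) * g + Poly_Mapping.single m c * laurent_deriv g"
  proof (induction g rule: pm_induct)
    case zero
    show ?case by simp
  next
    case (add n d r)
    then show ?case
      by (simp add: distrib_left distrib_right laurent_deriv_add laurent_deriv_single mult_single
          algebra_simps flip: single_add)
  qed
  with add show ?case
    by (simp add: distrib_left distrib_right laurent_deriv_add algebra_simps)
qed

lemma laurent_res_simps:
  "laurent_res (f + g) = laurent_res f + laurent_res g"
  "laurent_res (f - g) = laurent_res f - laurent_res g"
  "laurent_res (- f) = - laurent_res f"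
  "laurent_res 0 = 0"
  by (simp_all add: laurent_res_def lookup_add lookup_minus)

lemma laurent_res_deriv [simp]: "laurent_res (laurent_deriv f) = 0"
  by (simp add: laurent_res_def lookup_laurent_deriv)

lemma laurent_deriv_uminus: "laurent_deriv (- f) = - laurent_deriv f"
  using laurent_deriv_diff[of 0 f] by simp

lemma lookup_const_mult:
  "Poly_Mapping.lookup (Poly_Mapping.single 0 a * f) k = a * Poly_Mapping.lookup f k"
  for f :: "'a::comm_monoid_add \<Rightarrow>\<^sub>0 complex"
  by (auto simp flip: mult_map_scale_conv_mult simp: Poly_Mapping.map.rep_eq when_def)

lemma laurent_res_cocycle:
  "laurent_res (laurent_deriv f * laurent_deriv (laurent_deriv g)
      - laurent_deriv g * laurent_deriv (laurent_deriv f))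
   = 2 * laurent_res (laurent_deriv f * laurent_deriv (laurent_deriv g))"
proof -
  have "laurent_res (laurent_deriv (laurent_deriv f * laurent_deriv g)) = 0"
    by simp
  then have "laurent_res (laurent_deriv (laurent_deriv f) * laurent_deriv g)
      + laurent_res (laurent_deriv f * laurent_deriv (laurent_deriv g)) = 0"
    by (simp only: laurent_deriv_mult laurent_res_simps)
  then show ?thesis
    by (simp add: laurent_res_simps mult.commute add_eq_0_iff)
qed

lemma vir_bracket_pair:
  "vir_bracket (f, a) (g, b) =
     (f * laurent_deriv g - laurent_deriv f * g,
      2 * laurent_res (laurent_deriv f * laurent_deriv (laurent_deriv g)))"
  by (simp add: vir_bracket_def Let_def laurent_res_cocycle)

lemma vir_bracket_self: "vir_bracket u u = 0"
  by (simp add: vir_bracket_def Let_def laurent_res_simps prod_eq_iff)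

lemma vir_bracket_add: "vir_bracket (u + v) w = vir_bracket u w + vir_bracket v w"
  by (cases u; cases v; cases w)
     (simp add: vir_bracket_pair laurent_deriv_add laurent_res_simps algebra_simps)

lemma vir_bracket_anti: "vir_bracket u v = - vir_bracket v u"
  by (cases u; cases v)
     (simp add: vir_bracket_def Let_def laurent_res_simps mult.commute)

lemma laurent_deriv_scale:
  "laurent_deriv (Poly_Mapping.single 0 c * f) = Poly_Mapping.single 0 c * laurent_deriv f"
  by (simp add: laurent_deriv_mult laurent_deriv_single)

lemma vir_bracket_scale: "vir_bracket (vir_scale c u) w = vir_scale c (vir_bracket u w)"
  by (cases u; cases w)
     (simp add: vir_bracket_pair vir_scale_def laurent_deriv_scale laurent_res_def
       lookup_const_mult mult.assoc right_diff_distrib)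

lemma vir_bracket_jacobi:
  "vir_bracket u (vir_bracket v w) + vir_bracket v (vir_bracket w u)
     + vir_bracket w (vir_bracket u v) = 0"
proof -
  have "vir_bracket (vir_bracket u v) w + vir_bracket (vir_bracket v w) u
     + vir_bracket (vir_bracket w u) v = 0"
    by (cases u; cases v; cases w)
       (simp add: vir_bracket_pair laurent_deriv_diff laurent_deriv_mult laurent_res_simps
         algebra_simps zero_prod_def)
  then show ?thesis
    using vir_bracket_anti[of "vir_bracket u v" w] vir_bracket_anti[of "vir_bracket v w" u]
      vir_bracket_anti[of "vir_bracket w u" v]
    by (simp add: add_eq_0_iff algebra_simps)
qed

lemma pm_sum_superset:
  assumes "finite K" "Poly_Mapping.keys p \<subseteq> K" "\<And>m. F m 0 = 0"
  shows "(\<Sum>m\<in>Poly_Mapping.keys p. F m (Poly_Mapping.lookup p m))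
       = (\<Sum>m\<in>K. F m (Poly_Mapping.lookup p m))"
  by (rule sum.mono_neutral_left)
     (use assms in \<open>auto simp: Poly_Mapping.in_keys_iff\<close>)

lemma pm_sum_add:
  assumes "\<And>m. F m 0 = 0" "\<And>m a b. F m (a + b) = F m a + F m b"
  shows "(\<Sum>m\<in>Poly_Mapping.keys (p + q). F m (Poly_Mapping.lookup (p + q) m))
       = (\<Sum>m\<in>Poly_Mapping.keys p. F m (Poly_Mapping.lookup p m))
         + (\<Sum>m\<in>Poly_Mapping.keys q. F m (Poly_Mapping.lookup q m))"
proof -
  let ?K = "Poly_Mapping.keys p \<union> Poly_Mapping.keys q"
  have "Poly_Mapping.keys (p + q) \<subseteq> ?K"
    by (rule Poly_Mapping.keys_add)
  then show ?thesis
    using pm_sum_superset[of ?K "p + q" F] pm_sum_superset[of ?K p F]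
      pm_sum_superset[of ?K q F] assms
    by (simp add: lookup_add sum.distrib)
qed

lemma pm_sum_single:
  assumes "F m 0 = 0"
  shows "(\<Sum>k\<in>Poly_Mapping.keys (Poly_Mapping.single m c).
           F k (Poly_Mapping.lookup (Poly_Mapping.single m c) k)) = F m c"
  using assms by (cases "c = 0") auto

lemma sym_const_simps:
  "sym_const 0 = 0" "sym_const 1 = 1" "sym_const (a + b) = sym_const a + sym_const b"
  "sym_const (a * b) = sym_const a * sym_const b" "sym_const (- a) = - sym_const a"
  by (simp_all add: sym_const_def single_add mult_single single_uminus)

lemma sym_incl_add: "sym_incl (u + v) = sym_incl u + sym_incl v"
proof -
  have "(\<Sum>n\<in>Poly_Mapping.keys (fst u + fst v).
          sym_const (Poly_Mapping.lookup (fst u + fst v) n) * sym_var (Vec n)) =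
    (\<Sum>n\<in>Poly_Mapping.keys (fst u). sym_const (Poly_Mapping.lookup (fst u) n) * sym_var (Vec n)) +
    (\<Sum>n\<in>Poly_Mapping.keys (fst v). sym_const (Poly_Mapping.lookup (fst v) n) * sym_var (Vec n))"
    by (rule pm_sum_add[where F = "\<lambda>n c. sym_const c * sym_var (Vec n)"])
       (simp_all add: sym_const_simps algebra_simps)
  then show ?thesis
    by (simp add: sym_incl_def sym_const_simps algebra_simps)
qed

lemma sym_incl_scale: "sym_incl (vir_scale c u) = sym_const c * sym_incl u"
proof -
  have "Poly_Mapping.keys (Poly_Mapping.single 0 c * fst u) \<subseteq> Poly_Mapping.keys (fst u)"
    by (auto simp: Poly_Mapping.in_keys_iff lookup_const_mult)
  from pm_sum_superset[OF _ this, where F = "\<lambda>n c. sym_const c * sym_var (Vec n)"]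
  show ?thesis
    by (simp add: sym_incl_def vir_scale_def sym_const_simps lookup_const_mult
        sum_distrib_left distrib_left mult.assoc)
qed

lemma sym_incl_zero [simp]: "sym_incl 0 = 0"
  by (simp add: sym_incl_def sym_const_simps)

lemma sym_incl_uminus: "sym_incl (- u) = - sym_incl u"
  using sym_incl_add[of u "- u"] by (simp add: eq_neg_iff_add_eq_0 add.commute)

lemma sym_incl_vec [simp]: "sym_incl (vir_vec b) = sym_var b"
  by (cases b) (simp_all add: sym_incl_def sym_const_simps)

lemma vir_expand:
  "u = (\<Sum>n\<in>Poly_Mapping.keys (fst u). vir_scale (Poly_Mapping.lookup (fst u) n) (vir_vec (Vec n)))
       + vir_scale (snd u) (vir_vec Central)"
proof (rule prod_eqI)
  show "fst u = fst ((\<Sum>n\<in>Poly_Mapping.keys (fst u).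
      vir_scale (Poly_Mapping.lookup (fst u) n) (vir_vec (Vec n)))
       + vir_scale (snd u) (vir_vec Central))"
    using pm_expand[of "fst u"] by (simp add: fst_sum vir_scale_def mult_single)
qed (simp add: snd_sum vir_scale_def)

lemma vir_induct [case_names vec add scale]:
  assumes "\<And>b. P (vir_vec b)" "\<And>u v. P u \<Longrightarrow> P v \<Longrightarrow> P (u + v)"
    "\<And>c u. P u \<Longrightarrow> P (vir_scale c u)"
  shows "P u"
proof -
  have z: "P 0"
    using assms(3)[OF assms(1), of 0] by (simp add: vir_scale_def zero_prod_def)
  have "P (\<Sum>n\<in>K. vir_scale (Poly_Mapping.lookup (fst u) n) (vir_vec (Vec n)))"
    if "finite K" for K
    using that by (induction K) (auto intro: assms z simp del: vir_vec.simps)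
  from this[of "Poly_Mapping.keys (fst u)"]
  have "P ((\<Sum>n\<in>Poly_Mapping.keys (fst u). vir_scale (Poly_Mapping.lookup (fst u) n) (vir_vec (Vec n)))
       + vir_scale (snd u) (vir_vec Central))"
    by (intro assms) auto
  then show ?thesis
    using vir_expand[of u] by simp
qed

lemma sym_induct [case_names const var add mult]:
  assumes c: "\<And>a. P (sym_const a)" and v: "\<And>b. P (sym_var b)"
    and a: "\<And>p q. P p \<Longrightarrow> P q \<Longrightarrow> P (p + q)" and m: "\<And>p q. P p \<Longrightarrow> P q \<Longrightarrow> P (p * q)"
  shows "P p"
proof (induction p rule: pm_induct)
  case zero
  show ?case using c[of 0] by (simp add: sym_const_simps)
next
  case (add e x q)
  have pw: "P (Poly_Mapping.single (Poly_Mapping.single b k) 1)" for b k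
  proof (induction k)
    case 0
    show ?case using c[of 1] by (simp add: sym_const_def)
  next
    case (Suc k)
    have "Poly_Mapping.single (Poly_Mapping.single b (Suc k)) (1::complex)
      = sym_var b * Poly_Mapping.single (Poly_Mapping.single b k) 1"
      by (simp add: sym_var_def mult_single flip: single_add)
    then show ?case using m[OF v Suc] by simp
  qed
  have "P (Poly_Mapping.single e x)"
  proof (induction e rule: pm_induct)
    case zero
    show ?case using c[of x] by (simp add: sym_const_def)
  next
    case (add b k e')
    have "Poly_Mapping.single (Poly_Mapping.single b k + e') x
       = Poly_Mapping.single (Poly_Mapping.single b k) 1 * Poly_Mapping.single e' x"
      by (simp add: mult_single)
    then show ?case using m[OF pw add] by simp
  qed
  with add show ?case by (intro a)
qed

theorem symvir_universal:
  fixes \<kappa> :: "complex \<Rightarrow> 'b::comm_ring_1" and \<phi> :: "vir \<Rightarrow> 'b"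
  assumes \<kappa>: "\<kappa> 1 = 1" "\<And>a b. \<kappa> (a + b) = \<kappa> a + \<kappa> b" "\<And>a b. \<kappa> (a * b) = \<kappa> a * \<kappa> b"
    and \<phi>: "\<And>u v. \<phi> (u + v) = \<phi> u + \<phi> v" "\<And>a u. \<phi> (vir_scale a u) = \<kappa> a * \<phi> u"
  shows "\<exists>!F. (\<forall>p q. F (p + q) = F p + F q) \<and> (\<forall>p q. F (p * q) = F p * F q)
            \<and> (\<forall>a. F (sym_const a) = \<kappa> a) \<and> (\<forall>u. F (sym_incl u) = \<phi> u)"
proof (rule ex_ex1I)
  have \<kappa>0: "\<kappa> 0 = 0" using \<kappa>(2)[of 0 0] by simp
  define E :: "(vir_basis \<Rightarrow>\<^sub>0 nat) \<Rightarrow> 'b"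
    where "E m = (\<Prod>b\<in>Poly_Mapping.keys m. \<phi> (vir_vec b) ^ Poly_Mapping.lookup m b)" for m
  have E_super: "E m = (\<Prod>b\<in>K. \<phi> (vir_vec b) ^ Poly_Mapping.lookup m b)"
    if "finite K" "Poly_Mapping.keys m \<subseteq> K" for m K
    unfolding E_def by (rule prod.mono_neutral_left)
      (use that in \<open>auto simp: Poly_Mapping.in_keys_iff\<close>)
  have E_add: "E (m + n) = E m * E n" for m n
  proof -
    let ?K = "Poly_Mapping.keys m \<union> Poly_Mapping.keys n"
    have "Poly_Mapping.keys (m + n) \<subseteq> ?K" by (rule Poly_Mapping.keys_add)
    then show ?thesis
      using E_super[of ?K "m + n"] E_super[of ?K m] E_super[of ?K n]
      by (simp add: lookup_add power_add prod.distrib)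
  qed
  define F :: "symvir \<Rightarrow> 'b"
    where "F p = (\<Sum>m\<in>Poly_Mapping.keys p. \<kappa> (Poly_Mapping.lookup p m) * E m)" for p
  have F_add: "F (p + q) = F p + F q" for p q
    unfolding F_def
    by (rule pm_sum_add[where F = "\<lambda>m c. \<kappa> c * E m"]) (simp_all add: \<kappa> \<kappa>0 algebra_simps)
  have F_single: "F (Poly_Mapping.single m c) = \<kappa> c * E m" for m c
    unfolding F_def
    by (rule pm_sum_single[where F = "\<lambda>m c. \<kappa> c * E m"]) (simp add: \<kappa>0)
  have F0: "F 0 = 0" by (simp add: F_def)
  have F_mult: "F (p * q) = F p * F q" for p q
  proof (induction p rule: pm_induct)
    case zero
    show ?case by (simp add: F0)
  next
    case (add m c p')
    have "F (Poly_Mapping.single m c * q) = F (Poly_Mapping.single m c) * F q"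
      by (induction q rule: pm_induct)
         (simp_all add: F0 distrib_left F_add F_single mult_single E_add \<kappa> ac_simps)
    with add show ?case by (simp add: distrib_right F_add)
  qed
  have F_const: "F (sym_const a) = \<kappa> a" for a
    by (simp add: sym_const_def F_single E_def)
  have F_var: "F (sym_var b) = \<phi> (vir_vec b)" for b
    by (simp add: sym_var_def F_single E_def \<kappa>)
  have "F (sym_incl u) = \<phi> u" for u
    by (induction u rule: vir_induct)
       (simp_all add: F_var sym_incl_add F_add \<phi> sym_incl_scale F_mult F_const del: vir_vec.simps)
  with F_add F_mult F_const
  show "\<exists>F. (\<forall>p q. F (p + q) = F p + F q) \<and> (\<forall>p q. F (p * q) = F p * F q)
            \<and> (\<forall>a. F (sym_const a) = \<kappa> a) \<and> (\<forall>u. F (sym_incl u) = \<phi> u)"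
    by blast
next
  fix F G :: "symvir \<Rightarrow> 'b"
  assume F: "(\<forall>p q. F (p + q) = F p + F q) \<and> (\<forall>p q. F (p * q) = F p * F q)
            \<and> (\<forall>a. F (sym_const a) = \<kappa> a) \<and> (\<forall>u. F (sym_incl u) = \<phi> u)"
    and G: "(\<forall>p q. G (p + q) = G p + G q) \<and> (\<forall>p q. G (p * q) = G p * G q)
            \<and> (\<forall>a. G (sym_const a) = \<kappa> a) \<and> (\<forall>u. G (sym_incl u) = \<phi> u)"
  have "F p = G p" for p
  proof (induction p rule: sym_induct)
    case (var b)
    have "F (sym_incl (vir_vec b)) = G (sym_incl (vir_vec b))"
      using F G by metis
    then show ?case by simp
  qed (use F G in simp_all)
  then show "F = G" by blast
qed

lemma sym_pdiff_add: "sym_pdiff b (p + q) = sym_pdiff b p + sym_pdiff b q"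
  unfolding sym_pdiff_def
  by (rule pm_sum_add[where F = "\<lambda>m c. Poly_Mapping.single (m - Poly_Mapping.single b 1)
        (of_nat (Poly_Mapping.lookup m b) * c)"])
     (simp_all add: single_add distrib_left)

lemma sym_pdiff_single:
  "sym_pdiff b (Poly_Mapping.single m c) =
     Poly_Mapping.single (m - Poly_Mapping.single b 1) (of_nat (Poly_Mapping.lookup m b) * c)"
  unfolding sym_pdiff_def
  by (rule pm_sum_single[where F = "\<lambda>m c. Poly_Mapping.single (m - Poly_Mapping.single b 1)
        (of_nat (Poly_Mapping.lookup m b) * c)"]) simp

lemma sym_pdiff_zero [simp]: "sym_pdiff b 0 = 0"
  by (simp add: sym_pdiff_def)

lemma sym_pdiff_const [simp]: "sym_pdiff b (sym_const a) = 0"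
  by (simp add: sym_const_def sym_pdiff_single)

lemma sym_pdiff_var: "sym_pdiff b (sym_var a) = (if a = b then 1 else 0)"
  by (simp add: sym_var_def sym_pdiff_single lookup_single)

lemma single_add_diff:
  fixes m n :: "'a \<Rightarrow>\<^sub>0 nat"
  assumes "Poly_Mapping.lookup n b \<noteq> 0"
  shows "m + n - Poly_Mapping.single b 1 = m + (n - Poly_Mapping.single b 1)"
  by (rule poly_mapping_eqI)
     (use assms in \<open>auto simp: lookup_add lookup_minus lookup_single when_def\<close>)

lemma sym_pdiff_mult_single:
  "sym_pdiff b (Poly_Mapping.single m c * Poly_Mapping.single n d) =
     sym_pdiff b (Poly_Mapping.single m c) * Poly_Mapping.single n d
     + Poly_Mapping.single m c * sym_pdiff b (Poly_Mapping.single n d)"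
proof -
  have 1: "Poly_Mapping.single m c * sym_pdiff b (Poly_Mapping.single n d) =
    Poly_Mapping.single (m + n - Poly_Mapping.single b 1) (of_nat (Poly_Mapping.lookup n b) * (c * d))"
    for m n c d
    by (cases "Poly_Mapping.lookup n b = 0")
       (simp_all add: sym_pdiff_single mult_single single_add_diff mult.left_commute del: One_nat_def)
  have 2: "sym_pdiff b (Poly_Mapping.single m c) * Poly_Mapping.single n d =
    Poly_Mapping.single (m + n - Poly_Mapping.single b 1) (of_nat (Poly_Mapping.lookup m b) * (c * d))"
    using 1[of n d m c] by (simp add: ac_simps)
  show ?thesis
    unfolding 1 2 by (simp add: mult_single sym_pdiff_single lookup_add distrib_right single_add)
qed

lemma sym_pdiff_mult: "sym_pdiff b (p * q) = sym_pdiff b p * q + p * sym_pdiff b q"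
proof (induction p rule: pm_induct)
  case zero
  show ?case by simp
next
  case (add m c p')
  have "sym_pdiff b (Poly_Mapping.single m c * q) =
     sym_pdiff b (Poly_Mapping.single m c) * q + Poly_Mapping.single m c * sym_pdiff b q"
  proof (induction q rule: pm_induct)
    case zero
    show ?case by simp
  next
    case (add n d r)
    then show ?case
      by (simp only: distrib_left distrib_right sym_pdiff_add sym_pdiff_mult_single ac_simps)
  qed
  with add show ?case
    by (simp only: distrib_left distrib_right sym_pdiff_add ac_simps)
qed

lemma finite_sym_vars [simp]: "finite (sym_vars p)"
  by (simp add: sym_vars_def)

lemma sym_pdiff_not_in_vars: "b \<notin> sym_vars p \<Longrightarrow> sym_pdiff b p = 0"
  by (auto simp: sym_pdiff_def sym_vars_def Poly_Mapping.in_keys_iff intro!: sum.neutral)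

lemma sym_bracket_superset:
  assumes "finite U" "sym_vars p \<subseteq> U" "finite V" "sym_vars q \<subseteq> V"
  shows "sym_bracket p q = (\<Sum>a\<in>U. \<Sum>b\<in>V. sym_pdiff a p * sym_pdiff b q
            * sym_incl (vir_bracket (vir_vec a) (vir_vec b)))"
proof -
  have "sym_bracket p q = (\<Sum>a\<in>sym_vars p. \<Sum>b\<in>V. sym_pdiff a p * sym_pdiff b q
            * sym_incl (vir_bracket (vir_vec a) (vir_vec b)))"
    unfolding sym_bracket_def
    by (intro sum.cong sum.mono_neutral_left)
       (use assms in \<open>auto simp: sym_pdiff_not_in_vars\<close>)
  also have "\<dots> = (\<Sum>a\<in>U. \<Sum>b\<in>V. sym_pdiff a p * sym_pdiff b q
            * sym_incl (vir_bracket (vir_vec a) (vir_vec b)))"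
    by (intro sum.mono_neutral_left)
       (use assms in \<open>auto simp: sym_pdiff_not_in_vars\<close>)
  finally show ?thesis .
qed

lemma sym_bracket_add: "sym_bracket (p + q) r = sym_bracket p r + sym_bracket q r"
proof -
  let ?U = "sym_vars p \<union> sym_vars q \<union> sym_vars (p + q)"
  show ?thesis
    using sym_bracket_superset[of ?U p "sym_vars r" r]
      sym_bracket_superset[of ?U q "sym_vars r" r]
      sym_bracket_superset[of ?U "p + q" "sym_vars r" r]
    by (simp add: sym_pdiff_add sum.distrib distrib_right Un_assoc le_supI2)
qed

lemma sym_bracket_mult:
  "sym_bracket (p * q) r = p * sym_bracket q r + sym_bracket p r * q"
proof -
  let ?U = "sym_vars p \<union> sym_vars q \<union> sym_vars (p * q)"
  have "sym_bracket (p * q) r = (\<Sum>a\<in>?U. \<Sum>b\<in>sym_vars r. sym_pdiff a (p * q) * sym_pdiff b r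
            * sym_incl (vir_bracket (vir_vec a) (vir_vec b)))"
    by (rule sym_bracket_superset) auto
  also have "\<dots> = p * (\<Sum>a\<in>?U. \<Sum>b\<in>sym_vars r. sym_pdiff a q * sym_pdiff b r
            * sym_incl (vir_bracket (vir_vec a) (vir_vec b)))
         + (\<Sum>a\<in>?U. \<Sum>b\<in>sym_vars r. sym_pdiff a p * sym_pdiff b r
            * sym_incl (vir_bracket (vir_vec a) (vir_vec b))) * q"
    by (simp add: sym_pdiff_mult sum_distrib_left sum_distrib_right distrib_right
        distrib_left sum.distrib ac_simps)
  also have "\<dots> = p * sym_bracket q r + sym_bracket p r * q"
    by (intro arg_cong2[where f = plus] arg_cong2[where f = times] refl
        sym_bracket_superset[symmetric]) auto
  finally show ?thesis .
qed

lemma sym_bracket_const [simp]: "sym_bracket (sym_const a) r = 0"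
  by (simp add: sym_bracket_def)

lemma sym_bracket_anti: "sym_bracket p q = - sym_bracket q p"
proof -
  have "sym_bracket q p = (\<Sum>a\<in>sym_vars p. \<Sum>b\<in>sym_vars q. sym_pdiff b q * sym_pdiff a p
            * sym_incl (vir_bracket (vir_vec b) (vir_vec a)))"
    unfolding sym_bracket_def by (rule sum.swap)
  also have "\<dots> = (\<Sum>a\<in>sym_vars p. \<Sum>b\<in>sym_vars q. - (sym_pdiff a p * sym_pdiff b q
            * sym_incl (vir_bracket (vir_vec a) (vir_vec b))))"
  proof (intro sum.cong refl)
    fix a b
    show "sym_pdiff b q * sym_pdiff a p * sym_incl (vir_bracket (vir_vec b) (vir_vec a))
      = - (sym_pdiff a p * sym_pdiff b q * sym_incl (vir_bracket (vir_vec a) (vir_vec b)))"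
      using vir_bracket_anti[of "vir_vec b" "vir_vec a"] by (simp add: sym_incl_uminus)
  qed
  also have "\<dots> = - sym_bracket p q"
    by (simp add: sym_bracket_def sum_negf)
  finally show ?thesis by simp
qed

lemma sym_vars_var [simp]: "sym_vars (sym_var b) = {b}"
  by (simp add: sym_vars_def sym_var_def)

lemma sym_bracket_var:
  "sym_bracket (sym_var a) (sym_var b) = sym_incl (vir_bracket (vir_vec a) (vir_vec b))"
  by (simp add: sym_bracket_def sym_pdiff_var)

lemma sym_bracket_right:
  "sym_bracket r (p + q) = sym_bracket r p + sym_bracket r q"
  "sym_bracket r (p * q) = p * sym_bracket r q + sym_bracket r p * q"
  "sym_bracket r (sym_const a) = 0"
  using sym_bracket_anti[of r "p + q"] sym_bracket_anti[of r "p * q"]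
    sym_bracket_anti[of r "sym_const a"] sym_bracket_anti[of r p] sym_bracket_anti[of r q]
  by (simp_all add: sym_bracket_add sym_bracket_mult)

lemma vir_bracket_right:
  "vir_bracket w (u + v) = vir_bracket w u + vir_bracket w v"
  "vir_bracket w (vir_scale c u) = vir_scale c (vir_bracket w u)"
  using vir_bracket_anti[of w "u + v"] vir_bracket_anti[of w u] vir_bracket_anti[of w v]
    vir_bracket_anti[of w "vir_scale c u"]
  by (simp_all add: vir_bracket_add vir_bracket_scale) (simp add: vir_scale_def)

lemma sym_bracket_incl: "sym_bracket (sym_incl u) (sym_incl v) = sym_incl (vir_bracket u v)"
proof (induction u rule: vir_induct)
  case (vec b)
  show ?case
    by (induction v rule: vir_induct)
       (simp_all add: sym_bracket_var sym_incl_add sym_bracket_right vir_bracket_right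
         sym_incl_scale del: vir_vec.simps)
qed (simp_all add: sym_incl_add sym_bracket_add vir_bracket_add sym_incl_scale
    sym_bracket_mult vir_bracket_scale)

lemma sym_bracket_self: "sym_bracket p p = 0"
proof -
  have eq: "(x::symvir) = - x \<Longrightarrow> x = 0" for x
  proof -
    assume x: "x = - x"
    have "Poly_Mapping.lookup x k = 0" for k
      using arg_cong[OF x, of "\<lambda>x. Poly_Mapping.lookup x k"] by simp
    then show ?thesis by (intro poly_mapping_eqI) simp
  qed
  show ?thesis by (rule eq) (rule sym_bracket_anti)
qed

lemma sym_bracket_jacobi:
  "sym_bracket p (sym_bracket q r) + sym_bracket q (sym_bracket r p)
     + sym_bracket r (sym_bracket p q) = 0"
proof -
  define J where "J p q r = sym_bracket p (sym_bracket q r) + sym_bracket q (sym_bracket r p)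
     + sym_bracket r (sym_bracket p q)" for p q r
  have cyc: "J p q r = J q r p" for p q r
    by (simp add: J_def ac_simps)
  have const: "J (sym_const a) q r = 0" for a q r
    using sym_bracket_right(3)[of _ 0]
    by (simp add: J_def sym_bracket_right sym_const_simps)
  have add: "J (p + p') q r = J p q r + J p' q r" for p p' q r
    by (simp add: J_def sym_bracket_add sym_bracket_right)
  have mult: "J (p * p') q r = p * J p' q r + J p q r * p'" for p p' q r
    unfolding J_def sym_bracket_mult sym_bracket_right
      sym_bracket_anti[of p q] sym_bracket_anti[of p' q]
      sym_bracket_anti[of "- sym_bracket q p"]
    by (simp add: algebra_simps)
  have var: "J (sym_var a) (sym_var b) (sym_var c) = 0" for a b c
    using vir_bracket_jacobi[of "vir_vec a" "vir_vec b" "vir_vec c"]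
    unfolding J_def sym_incl_vec[symmetric] sym_bracket_incl sym_incl_add[symmetric]
    by simp
  have 1: "J p (sym_var b) (sym_var c) = 0" for p b c
    by (induction p rule: sym_induct) (simp_all add: const var add mult)
  have 2: "J q (sym_var c) p = 0" for p q c
  proof (induction q rule: sym_induct)
    case (var b)
    show ?case using 1[of p b c] cyc[of p] by simp
  qed (simp_all add: const add mult)
  have "J r p q = 0"
  proof (induction r rule: sym_induct)
    case (var c)
    show ?case using 2[of q c p] cyc[of q] by simp
  qed (simp_all add: const add mult)
  then show ?thesis using cyc[of r p q] by (simp add: J_def)
qed

theorem sym_bracket_unique:
  assumes add: "\<And>p q r. br (p + q) r = br p r + br q r"
    and const: "\<And>a r. br (sym_const a) r = 0"
    and leibniz: "\<And>p q r. br (p * q) r = p * br q r + br p r * q"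
    and anti: "\<And>p q. br p q = - br q p"
    and incl: "\<And>u v. br (sym_incl u) (sym_incl v) = sym_incl (vir_bracket u v)"
  shows "br = sym_bracket"
proof -
  have 1: "br p (sym_var b) = sym_bracket p (sym_var b)" for p b
  proof (induction p rule: sym_induct)
    case (var a)
    show ?case
      using incl[of "vir_vec a" "vir_vec b"] by (simp add: sym_bracket_var)
  qed (simp_all add: const add leibniz sym_bracket_add sym_bracket_mult)
  have "br q p = sym_bracket q p" for p q
  proof (induction q rule: sym_induct)
    case (var b)
    show ?case
      using 1[of p b] anti[of "sym_var b" p] sym_bracket_anti[of "sym_var b" p] by simp
  qed (simp_all add: const add leibniz sym_bracket_add sym_bracket_mult)
  then show ?thesis by blast
qed

lemma symvir_cring: "cring S_Vir"
proof -
  have "\<exists>y. x + y = 0" for x :: symvir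
    using add.right_inverse by blast
  then show ?thesis
    unfolding S_Vir_def by unfold_locales (auto simp: algebra_simps Units_def add_eq_0_iff)
qed

theorem symvir_poisson_algebra: "poisson_algebra ring_of_type_algebra S_Vir"
proof -
  interpret S: cring S_Vir by (rule symvir_cring)
  have C: "cring (ring_of_type_algebra :: complex ring)"
    by (rule cring_from_type_algebra)
  have minus: "\<ominus>\<^bsub>S_Vir\<^esub> x = - x" for x
    by (rule S.minus_equality) (simp_all add: S_Vir_def)
  show ?thesis
  proof (intro poisson_algebra.intro algebraI poisson_algebra_axioms.intro C symvir_cring)
    fix x y assume "x \<in> carrier S_Vir" "y \<in> carrier S_Vir"
    show "pbracket S_Vir x y = \<ominus>\<^bsub>S_Vir\<^esub> pbracket S_Vir y x"
      unfolding minus by (simp add: S_Vir_def sym_bracket_anti[of x y])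
  qed (simp_all add: S_Vir_def ring_of_type_algebra_def sym_const_simps sym_bracket_add
         sym_bracket_mult sym_bracket_self sym_bracket_jacobi distrib_left distrib_right mult.assoc)
qed

context poisson_algebra
begin

lemma smult_in_ideal:
  assumes "ideal I A" "c \<in> carrier R" "x \<in> I"
  shows "c \<odot>\<^bsub>A\<^esub> x \<in> I"
proof -
  interpret ideal I A by fact
  have x: "x \<in> carrier A" using assms(3) by (rule a_Hcarr)
  have "(c \<odot>\<^bsub>A\<^esub> \<one>\<^bsub>A\<^esub>) \<otimes>\<^bsub>A\<^esub> x \<in> I"
    using assms by (intro I_l_closed) auto
  then show ?thesis
    using smult_assoc2[of c "\<one>\<^bsub>A\<^esub>" x] assms(2) x by simp
qed

lemma coset_absorb:
  assumes "ideal I A" "i \<in> I" "x \<in> carrier A"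
  shows "I +>\<^bsub>A\<^esub> (i \<oplus>\<^bsub>A\<^esub> x) = I +>\<^bsub>A\<^esub> x"
proof -
  interpret ideal I A by fact
  have "I +>\<^bsub>A\<^esub> i = I"
    by (rule a_coset_join2) (use assms(2) a_Hcarr a_subgroup in auto)
  then show ?thesis
    using a_coset_add_assoc[of I i x] assms a_subset a_Hcarr by simp
qed

lemma coset_elems:
  assumes "ideal I A" "x \<in> carrier A" "x' \<in> I +>\<^bsub>A\<^esub> x"
  obtains i where "i \<in> I" "x' = i \<oplus>\<^bsub>A\<^esub> x"
  using assms(3) by (auto simp: a_r_coset_def')

lemma coset_self:
  assumes "ideal I A" "x \<in> carrier A"
  shows "x \<in> I +>\<^bsub>A\<^esub> x"
proof -
  interpret ideal I A by fact
  show ?thesis using a_rcos_self assms(2) by blast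
qed

lemma quot_smult:
  assumes "ideal I A" "c \<in> carrier R" "x \<in> carrier A"
  shows "c \<odot>\<^bsub>poisson_quot A I\<^esub> (I +>\<^bsub>A\<^esub> x) = I +>\<^bsub>A\<^esub> (c \<odot>\<^bsub>A\<^esub> x)"
proof -
  interpret ideal I A by fact
  have "I +>\<^bsub>A\<^esub> (c \<odot>\<^bsub>A\<^esub> x') = I +>\<^bsub>A\<^esub> (c \<odot>\<^bsub>A\<^esub> x)" if x': "x' \<in> I +>\<^bsub>A\<^esub> x" for x'
  proof -
    obtain i where i: "i \<in> I" "x' = i \<oplus>\<^bsub>A\<^esub> x"
      using coset_elems[OF assms(1,3) x'] .
    show ?thesis
      using coset_absorb[OF assms(1) smult_in_ideal[OF assms(1,2) i(1)], of "c \<odot>\<^bsub>A\<^esub> x"]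
        assms i a_Hcarr[OF i(1)] by (simp add: smult_r_distr)
  qed
  then show ?thesis
    unfolding poisson_quot_def module.simps
    by (intro UN_constant_eq[OF coset_self[OF assms(1,3)]] ballI) blast
qed

lemma quot_pbracket:
  assumes "poisson_ideal I A" "x \<in> carrier A" "y \<in> carrier A"
  shows "pbracket (poisson_quot A I) (I +>\<^bsub>A\<^esub> x) (I +>\<^bsub>A\<^esub> y) = I +>\<^bsub>A\<^esub> pbracket A x y"
proof -
  have I: "ideal I A" and PI: "\<And>x y. x \<in> I \<Longrightarrow> y \<in> carrier A \<Longrightarrow> pbracket A x y \<in> I"
    using assms(1) by (auto simp: poisson_ideal_def)
  interpret ideal I A by fact
  have "I +>\<^bsub>A\<^esub> pbracket A x' y' = I +>\<^bsub>A\<^esub> pbracket A x y"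
    if x': "x' \<in> I +>\<^bsub>A\<^esub> x" and y': "y' \<in> I +>\<^bsub>A\<^esub> y" for x' y'
  proof -
    obtain i j where i: "i \<in> I" "x' = i \<oplus>\<^bsub>A\<^esub> x" and j: "j \<in> I" "y' = j \<oplus>\<^bsub>A\<^esub> y"
      by (rule coset_elems[OF I assms(2) x'], rule coset_elems[OF I assms(3) y'])
    have c: "i \<in> carrier A" "j \<in> carrier A" "y' \<in> carrier A" "x' \<in> carrier A"
      using i j a_Hcarr assms by auto
    have "I +>\<^bsub>A\<^esub> pbracket A x' y' = I +>\<^bsub>A\<^esub> (pbracket A i y' \<oplus>\<^bsub>A\<^esub> pbracket A x y')"
      using c assms i by (simp add: pbracket_add)
    also have "\<dots> = I +>\<^bsub>A\<^esub> pbracket A x y'"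
      using c assms i by (intro coset_absorb I PI) auto
    also have "pbracket A x y' = \<ominus>\<^bsub>A\<^esub> pbracket A j x \<oplus>\<^bsub>A\<^esub> pbracket A x y"
      using c assms j pbracket_anti[of x y'] pbracket_anti[of x y]
      by (simp add: pbracket_add M.minus_add)
    also have "I +>\<^bsub>A\<^esub> \<dots> = I +>\<^bsub>A\<^esub> pbracket A x y"
      using c assms j by (intro coset_absorb I a_inv_closed PI) auto
    finally show ?thesis .
  qed
  then show ?thesis
    unfolding poisson_quot_def poisson.simps
    by (intro UN_constant_eq[OF coset_self[OF I assms(2)]] UN_constant_eq[OF coset_self[OF I assms(3)]] ballI)
       blast
qed

theorem poisson_quot_poisson_algebra:
  assumes "poisson_ideal I A"
  shows "poisson_algebra R (poisson_quot A I)"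
proof -
  have I: "ideal I A" using assms by (simp add: poisson_ideal_def)
  interpret ideal I A by fact
  let ?Q = "poisson_quot A I"
  have Q: "cring (A Quot I)"
    by (rule quotient_is_cring) (rule M_cring)
  have sel: "carrier ?Q = carrier (A Quot I)" "monoid.mult ?Q = monoid.mult (A Quot I)"
    "one ?Q = one (A Quot I)" "ring.zero ?Q = ring.zero (A Quot I)"
    "add ?Q = add (A Quot I)"
    by (simp_all add: poisson_quot_def)
  interpret FQ: cring "A Quot I" by (rule Q)
  interpret Q: cring ?Q
  proof (intro cringI abelian_groupI comm_monoidI)
    fix U assume "U \<in> carrier ?Q"
    then show "\<exists>V\<in>carrier ?Q. V \<oplus>\<^bsub>?Q\<^esub> U = \<zero>\<^bsub>?Q\<^esub>"
      unfolding sel by (intro bexI[of _ "\<ominus>\<^bsub>A Quot I\<^esub> U"]) (simp_all add: FQ.l_neg)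
  qed (simp_all add: sel FQ.a_ac FQ.m_ac FQ.l_distr FQ.r_distr)
  have car: "\<exists>x\<in>carrier A. U = I +>\<^bsub>A\<^esub> x" if "U \<in> carrier ?Q" for U
    using that by (auto simp: sel FactRing_def A_RCOSETS_def')
  have cl: "I +>\<^bsub>A\<^esub> x \<in> carrier ?Q" if "x \<in> carrier A" for x
    using that by (auto simp: sel FactRing_def A_RCOSETS_def')
  have ops: "(I +>\<^bsub>A\<^esub> x) \<oplus>\<^bsub>?Q\<^esub> (I +>\<^bsub>A\<^esub> y) = I +>\<^bsub>A\<^esub> (x \<oplus>\<^bsub>A\<^esub> y)"
     "(I +>\<^bsub>A\<^esub> x) \<otimes>\<^bsub>?Q\<^esub> (I +>\<^bsub>A\<^esub> y) = I +>\<^bsub>A\<^esub> (x \<otimes>\<^bsub>A\<^esub> y)"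
     if "x \<in> carrier A" "y \<in> carrier A" for x y
    using that by (simp_all add: sel FactRing_def a_rcos_sum rcoset_mult_add)
  have zero: "\<zero>\<^bsub>?Q\<^esub> = I +>\<^bsub>A\<^esub> \<zero>\<^bsub>A\<^esub>"
    using a_coset_add_zero[OF a_subset] by (simp add: sel FactRing_def)
  have uminus: "\<ominus>\<^bsub>?Q\<^esub> (I +>\<^bsub>A\<^esub> x) = I +>\<^bsub>A\<^esub> (\<ominus>\<^bsub>A\<^esub> x)" if "x \<in> carrier A" for x
    using that by (intro Q.minus_equality) (simp_all add: ops cl zero M.l_neg)
  note s = quot_smult[OF I] quot_pbracket[OF assms] ops zero uminus
  show ?thesis
  proof (intro poisson_algebra.intro algebraI poisson_algebra_axioms.intro)
    fix U V W assume "U \<in> carrier ?Q" "V \<in> carrier ?Q" "W \<in> carrier ?Q"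
    then obtain x y w where [simp]: "U = I +>\<^bsub>A\<^esub> x" "V = I +>\<^bsub>A\<^esub> y" "W = I +>\<^bsub>A\<^esub> w"
      and x: "x \<in> carrier A" and y: "y \<in> carrier A" and w: "w \<in> carrier A"
      using car by metis
    note sxyw = s cl x y w
    show "pbracket ?Q U V \<in> carrier ?Q" "pbracket ?Q U U = \<zero>\<^bsub>?Q\<^esub>"
      by (simp_all add: sxyw pbracket_self)
    show "pbracket ?Q U V = \<ominus>\<^bsub>?Q\<^esub> pbracket ?Q V U"
      using pbracket_anti[OF x y] by (simp add: sxyw)
    show "pbracket ?Q (U \<oplus>\<^bsub>?Q\<^esub> V) W = pbracket ?Q U W \<oplus>\<^bsub>?Q\<^esub> pbracket ?Q V W"
      by (simp add: sxyw pbracket_add)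
    show "pbracket ?Q (U \<otimes>\<^bsub>?Q\<^esub> V) W
       = U \<otimes>\<^bsub>?Q\<^esub> pbracket ?Q V W \<oplus>\<^bsub>?Q\<^esub> pbracket ?Q U W \<otimes>\<^bsub>?Q\<^esub> V"
      by (simp add: sxyw pbracket_leibniz)
    show "pbracket ?Q U (pbracket ?Q V W) \<oplus>\<^bsub>?Q\<^esub> pbracket ?Q V (pbracket ?Q W U)
       \<oplus>\<^bsub>?Q\<^esub> pbracket ?Q W (pbracket ?Q U V) = \<zero>\<^bsub>?Q\<^esub>"
      by (simp add: sxyw pbracket_jacobi)
  next
    fix c d U V assume c: "c \<in> carrier R" and d: "d \<in> carrier R"
      and "U \<in> carrier ?Q" "V \<in> carrier ?Q"
    then obtain x y where [simp]: "U = I +>\<^bsub>A\<^esub> x" "V = I +>\<^bsub>A\<^esub> y"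
      and x: "x \<in> carrier A" and y: "y \<in> carrier A"
      using car by metis
    note sxy = s cl x y c d
    show "c \<odot>\<^bsub>?Q\<^esub> U \<in> carrier ?Q"
      by (simp add: sxy)
    show "(c \<oplus>\<^bsub>R\<^esub> d) \<odot>\<^bsub>?Q\<^esub> U = c \<odot>\<^bsub>?Q\<^esub> U \<oplus>\<^bsub>?Q\<^esub> d \<odot>\<^bsub>?Q\<^esub> U"
      by (simp add: sxy smult_l_distr)
    show "c \<odot>\<^bsub>?Q\<^esub> (U \<oplus>\<^bsub>?Q\<^esub> V) = c \<odot>\<^bsub>?Q\<^esub> U \<oplus>\<^bsub>?Q\<^esub> c \<odot>\<^bsub>?Q\<^esub> V"
      by (simp add: sxy smult_r_distr)
    show "(c \<otimes>\<^bsub>R\<^esub> d) \<odot>\<^bsub>?Q\<^esub> U = c \<odot>\<^bsub>?Q\<^esub> (d \<odot>\<^bsub>?Q\<^esub> U)"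
      by (simp add: sxy smult_assoc1)
    show "c \<odot>\<^bsub>?Q\<^esub> U \<otimes>\<^bsub>?Q\<^esub> V = c \<odot>\<^bsub>?Q\<^esub> (U \<otimes>\<^bsub>?Q\<^esub> V)"
      by (simp add: sxy smult_assoc2)
    show "pbracket ?Q (c \<odot>\<^bsub>?Q\<^esub> U) V = c \<odot>\<^bsub>?Q\<^esub> pbracket ?Q U V"
      by (simp add: sxy pbracket_smult)
  next
    fix U assume "U \<in> carrier ?Q"
    then obtain x where "U = I +>\<^bsub>A\<^esub> x" "x \<in> carrier A"
      using car by metis
    then show "\<one>\<^bsub>R\<^esub> \<odot>\<^bsub>?Q\<^esub> U = U"
      by (simp add: s)
  qed (rule R_cring Q.is_cring)+
qed

end

lemma vir_bracket_central: "vir_bracket (0, c) u = 0"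
  by (cases u) (simp add: vir_bracket_pair laurent_res_simps zero_prod_def)

lemma sym_bracket_central: "sym_bracket (sym_incl (0, 1) - sym_const \<zeta>) p = 0"
proof -
  have "sym_bracket p (sym_incl (0, 1)) = 0"
  proof (induction p rule: sym_induct)
    case (var b)
    have "sym_bracket (sym_incl (0, 1)) (sym_incl (vir_vec b)) = 0"
      unfolding sym_bracket_incl vir_bracket_central by simp
    then show ?case
      using sym_bracket_anti[of "sym_var b" "sym_incl (0, 1)"] by simp
  qed (simp_all add: sym_bracket_add sym_bracket_mult)
  moreover have "sym_incl (0, 1) - sym_const \<zeta> = sym_incl (0, 1) + sym_const (- \<zeta>)"
    by (simp add: sym_const_simps)
  ultimately show ?thesis
    using sym_bracket_anti[of "sym_incl (0, 1)" p]
    by (simp only: sym_bracket_add sym_bracket_const) simp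
qed

theorem central_ideal_poisson: "poisson_ideal (central_ideal \<zeta>) S_Vir"
proof -
  interpret S: cring S_Vir by (rule symvir_cring)
  let ?z = "sym_incl (0, 1) - sym_const \<zeta>"
  have z: "?z \<in> carrier S_Vir" by (simp add: S_Vir_def)
  have eq: "central_ideal \<zeta> = {p * ?z | p. True}"
    unfolding central_ideal_def S.cgenideal_eq_genideal[OF z, symmetric] cgenideal_def
    by (simp add: S_Vir_def)
  have "ideal (central_ideal \<zeta>) S_Vir"
    unfolding central_ideal_def using z by (intro S.genideal_ideal) auto
  moreover have "sym_bracket (p * ?z) q = sym_bracket p q * ?z" for p q
    by (simp add: sym_bracket_mult sym_bracket_central)
  ultimately show ?thesis
    unfolding poisson_ideal_def by (auto simp: eq S_Vir_def)
qed

theorem symvir_quot_poisson_algebra: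
  "poisson_algebra ring_of_type_algebra (poisson_quot S_Vir (central_ideal \<zeta>))"
  by (rule poisson_algebra.poisson_quot_poisson_algebra
      [OF symvir_poisson_algebra central_ideal_poisson])

end

theory Submission
  imports Defs
begin

text \<open>
  Write \<open>e\<^sub>i\<close> for the basis vector \<open>t\<^sup>i\<^sup>+\<^sup>1 \<partial>\<^sub>t\<close>, so that
  \<open>{e\<^sub>m, e\<^sub>i} = (i - m) e\<^sub>m\<^sub>+\<^sub>i + 2 (m\<^sup>3 - m) \<delta>\<^sub>m\<^sub>+\<^sub>i\<^sub>,\<^sub>0 z\<close>.
  A Poisson ideal of the quotient is the image of a Poisson ideal \<open>J\<close> of \<open>S(Vir)\<close> that contains
  \<open>z - \<zeta>\<close>.  If it is nonzero, then \<open>J\<close> contains a nonzero \<open>p\<close> in which \<open>z\<close> does not occur, since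
  \<open>z\<close> may be replaced by \<open>\<zeta>\<close>.  The goal is \<open>1 \<in> J\<close>, and \<open>J\<close> may be replaced by its
  radical, which is again a Poisson ideal.  So it suffices to lower the degree: if \<open>e\<^sub>N\<close> is the
  last mode that occurs in \<open>p \<in> J\<close>, then \<open>\<partial>p/\<partial>e\<^sub>N\<close> lies in the radical of \<open>J\<close>
  (by \<open>top_derivative_in\<close>).  Repeating this ends at a nonzero constant.

  Geometrically, a point \<open>\<chi>\<close> of the zero set of \<open>J\<close> is a formal quadratic differential \<open>\<phi>\<close>
  with central value \<open>\<zeta>\<close>, the differential of \<open>p\<close> at \<open>\<chi>\<close> is, modulo \<open>z\<close>, a vector field \<open>a \<partial>\<^sub>t\<close>
  with \<open>a\<close> a Laurent polynomial, and \<open>{e\<^sub>m, p} \<in> J\<close> for all \<open>m\<close> says that this vector field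
  stabilises \<open>\<chi>\<close>.  The stabiliser equation has the form \<open>2 \<phi> a' + \<phi>' a = c \<zeta> a'''\<close> with a constant
  \<open>c \<noteq> 0\<close>.  After multiplication by \<open>a\<close> it can be integrated: \<open>a\<^sup>2 \<phi>\<close> equals
  \<open>c \<zeta> (a a'' - a'\<^sup>2 / 2)\<close> up to an additive constant.
  If \<open>b \<partial>\<^sub>t\<close> is a second stabilising field, then multiplying its
  equation by \<open>a\<^sup>3\<close> and inserting the value of \<open>a\<^sup>2 \<phi>\<close> eliminates \<open>\<phi>\<close> and leaves a third order
  linear differential equation for \<open>b\<close> whose leading coefficient is \<open>\<zeta> a\<^sup>3\<close> up to a scalar.  Its
  solution space is finite-dimensional, whereas brackets with modes produce infinitely many
  elements of \<open>J\<close> with different last modes.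

  In coordinates only the highest coefficient of this equation matters.  If \<open>a\<close> and \<open>b\<close>
  have last indices \<open>0 < N < n\<close>, it is \<open>2 n (N\<^sup>2 - n\<^sup>2) z a\<^sub>N\<^sup>3 b\<^sub>n\<close>, whose numerical factor does
  not vanish; hence \<open>z a\<^sub>N\<^sup>3 b\<^sub>n \<in> J\<close> (\<open>top_derivatives_product_in\<close>).  Taking for
  \<open>b\<close> the differential of a bracket of the first element with a mode makes \<open>b\<^sub>n\<close> a nonzero
  multiple of \<open>a\<^sub>N\<close>, so that \<open>z a\<^sub>N\<^sup>4 \<in> J\<close>; modulo \<open>z - \<zeta>\<close> the factor \<open>z\<close> is an invertible scalar.
\<close>

section \<open>Partial derivatives in the symmetric algebra\<close>

lemma lookup_sym_pdiff:
  "Poly_Mapping.lookup (sym_pdiff b p) m =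
     of_nat (Poly_Mapping.lookup m b + 1) * Poly_Mapping.lookup p (m + Poly_Mapping.single b 1)"
proof (induction p rule: pm_induct)
  case zero
  show ?case by simp
next
  case (add k c q)
  have "Poly_Mapping.lookup (sym_pdiff b (Poly_Mapping.single k c)) m =
     of_nat (Poly_Mapping.lookup m b + 1)
       * Poly_Mapping.lookup (Poly_Mapping.single k c) (m + Poly_Mapping.single b 1)"
  proof (cases "k = m + Poly_Mapping.single b 1")
    case True
    have "m + Poly_Mapping.single b 1 - Poly_Mapping.single b 1 = m"
      by (rule poly_mapping_eqI) (simp add: lookup_add lookup_minus)
    with True show ?thesis
      by (simp add: sym_pdiff_single lookup_add)
  next
    case False
    have "Poly_Mapping.lookup k b = 0" if "k - Poly_Mapping.single b 1 = m"
    proof (rule ccontr)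
      assume nz: "Poly_Mapping.lookup k b \<noteq> 0"
      have "k = m + Poly_Mapping.single b 1"
        unfolding that[symmetric]
        by (rule poly_mapping_eqI) (use nz in \<open>auto simp: lookup_add lookup_minus lookup_single when_def\<close>)
      with False show False by contradiction
    qed
    with False show ?thesis
      by (auto simp: sym_pdiff_single lookup_single when_def)
  qed
  with add show ?case
    by (simp add: sym_pdiff_add lookup_add distrib_left)
qed

lemma sym_pdiff_commute: "sym_pdiff a (sym_pdiff b p) = sym_pdiff b (sym_pdiff a p)"
  by (rule poly_mapping_eqI)
     (cases "a = b", auto simp: lookup_sym_pdiff lookup_add lookup_single ac_simps)

lemma sym_pdiff_sum: "sym_pdiff b (\<Sum>i\<in>K. f i) = (\<Sum>i\<in>K. sym_pdiff b (f i))"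
  by (induction K rule: infinite_finite_induct) (simp_all add: sym_pdiff_add)

lemma sym_pdiff_of_int [simp]: "sym_pdiff b (of_int k) = 0"
proof -
  have nat: "sym_pdiff b (of_nat n) = 0" for n
    by (induction n) (use sym_pdiff_const[of b 1] in \<open>simp_all add: sym_pdiff_add sym_const_simps\<close>)
  have "sym_pdiff b (- of_nat n) = 0" for n
    using sym_pdiff_add[of b "of_nat n" "- of_nat n"] nat[of n] by simp
  with nat show ?thesis by (cases k rule: int_cases2) simp_all
qed

definition monomial_degree :: "(vir_basis \<Rightarrow>\<^sub>0 nat) \<Rightarrow> nat" where
  "monomial_degree m = (\<Sum>b\<in>Poly_Mapping.keys m. Poly_Mapping.lookup m b)"

lemma monomial_degree_add: "monomial_degree (m + k) = monomial_degree m + monomial_degree k"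
  unfolding monomial_degree_def by (rule pm_sum_add[where F = "\<lambda>b c. c"]) simp_all

definition degree_le :: "nat \<Rightarrow> symvir \<Rightarrow> bool" where
  "degree_le d p \<longleftrightarrow> (\<forall>m\<in>Poly_Mapping.keys p. monomial_degree m \<le> d)"

lemma degree_le_exists: "\<exists>d. degree_le d p"
  unfolding degree_le_def
  by (rule exI[of _ "Max (monomial_degree ` Poly_Mapping.keys p)"]) simp

lemma monomial_degree_pdiff_less:
  assumes "degree_le d p" "m \<in> Poly_Mapping.keys (sym_pdiff b p)"
  shows "monomial_degree m < d"
proof -
  have "m + Poly_Mapping.single b 1 \<in> Poly_Mapping.keys p"
    using assms(2) by (auto simp: Poly_Mapping.in_keys_iff lookup_sym_pdiff)
  moreover have "monomial_degree (Poly_Mapping.single b 1) = 1"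
    by (simp add: monomial_degree_def)
  ultimately show ?thesis
    using assms(1) by (force simp: degree_le_def monomial_degree_add)
qed

lemma pdiff_zero_imp_const:
  assumes "\<And>b. sym_pdiff b p = 0"
  shows "p = sym_const (Poly_Mapping.lookup p 0)"
proof (rule poly_mapping_eqI)
  fix m
  have "Poly_Mapping.lookup p m = 0" if "m \<noteq> 0"
  proof -
    obtain b where b: "Poly_Mapping.lookup m b \<noteq> 0"
      using \<open>m \<noteq> 0\<close> by (metis lookup_zero poly_mapping_eqI)
    have "m - Poly_Mapping.single b 1 + Poly_Mapping.single b 1 = m"
      by (rule poly_mapping_eqI) (use b in \<open>auto simp: lookup_add lookup_minus lookup_single when_def\<close>)
    then show ?thesis
      using lookup_sym_pdiff[of b p "m - Poly_Mapping.single b 1"] assms[of b]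
      by (simp del: of_nat_Suc of_nat_add)
  qed
  then show "Poly_Mapping.lookup p m = Poly_Mapping.lookup (sym_const (Poly_Mapping.lookup p 0)) m"
    by (auto simp: sym_const_def lookup_single when_def)
qed

lemma sym_const_of_int: "sym_const (of_int k) = of_int k"
proof -
  have nat: "sym_const (of_nat n) = of_nat n" for n
    by (induction n) (simp_all add: sym_const_simps)
  show ?thesis
    by (cases k rule: int_cases2) (simp_all add: nat sym_const_simps)
qed

section \<open>Poisson ideals and their radicals\<close>

locale symvir_poisson_ideal =
  fixes J :: "symvir set"
  assumes zero_in: "0 \<in> J"
    and add_in: "p \<in> J \<Longrightarrow> q \<in> J \<Longrightarrow> p + q \<in> J"
    and mult_in: "p \<in> J \<Longrightarrow> r * p \<in> J"
    and bracket_in: "p \<in> J \<Longrightarrow> sym_bracket p r \<in> J"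
begin

lemma uminus_in: "p \<in> J \<Longrightarrow> - p \<in> J"
  using mult_in[of p "- 1"] by simp

lemma diff_in: "p \<in> J \<Longrightarrow> q \<in> J \<Longrightarrow> p - q \<in> J"
  using add_in[of p "- q"] uminus_in[of q] by simp

lemma mult_right_in: "p \<in> J \<Longrightarrow> p * r \<in> J"
  using mult_in[of p r] by (simp add: mult.commute)

lemma sum_in: "(\<And>i. i \<in> K \<Longrightarrow> f i \<in> J) \<Longrightarrow> (\<Sum>i\<in>K. f i) \<in> J"
  by (induction K rule: infinite_finite_induct) (auto simp: zero_in add_in)

lemma bracket_left_in: "p \<in> J \<Longrightarrow> sym_bracket r p \<in> J"
  using sym_bracket_anti[of r p] uminus_in[OF bracket_in[of p r]] by simp

lemma const_cancel:
  assumes "sym_const c * p \<in> J" "c \<noteq> 0"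
  shows "p \<in> J"
proof -
  have "sym_const (inverse c) * (sym_const c * p) = p"
    using assms(2) by (simp add: sym_const_simps flip: mult.assoc sym_const_simps(4))
  with mult_in[OF assms(1), of "sym_const (inverse c)"] show ?thesis by simp
qed

lemma of_int_cancel:
  assumes "of_int k * p \<in> J" "k \<noteq> 0"
  shows "p \<in> J"
proof (rule const_cancel)
  show "sym_const (of_int k) * p \<in> J"
    using assms(1) by (simp add: sym_const_of_int)
qed (use assms(2) in simp)

definition radical :: "symvir set" where
  "radical = {p. \<exists>k. p ^ k \<in> J}"

lemma sym_bracket_power:
  "sym_bracket (p ^ Suc k) r = of_nat (Suc k) * p ^ k * sym_bracket p r"
proof (induction k)
  case (Suc k)
  then show ?case
    by (subst power_Suc, subst sym_bracket_mult) (simp add: algebra_simps)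
qed simp

text \<open>
  Bracketing \<open>p\<^sup>i\<^sup>+\<^sup>1 {p, r}\<^sup>2\<^sup>j \<in> J\<close> with \<open>r\<close> and multiplying by \<open>{p, r}\<close> trades one factor \<open>p\<close>
  for two factors \<open>{p, r}\<close>: the summand in which the power of \<open>{p, r}\<close> is differentiated keeps all of
  \<open>p\<^sup>i\<^sup>+\<^sup>1 {p, r}\<^sup>2\<^sup>j\<close> as a factor.  The integer factor \<open>i + 1\<close> is cancelled in characteristic zero.
\<close>

lemma radical_bracket:
  assumes "p ^ k \<in> J"
  shows "sym_bracket p r ^ (2 * k) \<in> J"
proof -
  let ?b = "sym_bracket p r"
  have "p ^ (k - j) * ?b ^ (2 * j) \<in> J" if "j \<le> k" for j
    using that
  proof (induction j)
    case 0
    show ?case using assms by simp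
  next
    case (Suc j)
    define i where "i = k - Suc j"
    have i: "k - j = Suc i" using Suc.prems by (simp add: i_def)
    have IH: "p ^ Suc i * ?b ^ (2 * j) \<in> J" using Suc i by simp
    have "p ^ Suc i * sym_bracket (?b ^ (2 * j)) r * ?b \<in> J"
    proof (cases j)
      case 0
      then show ?thesis using sym_bracket_const[of 1 r] by (simp add: sym_const_simps zero_in)
    next
      case (Suc j')
      have "p ^ Suc i * sym_bracket (?b ^ (2 * j)) r * ?b
          = p ^ Suc i * ?b ^ (2 * j) * (of_nat (2 * j) * sym_bracket ?b r)"
        using Suc sym_bracket_power[of ?b "2 * j - 1" r]
        by (simp add: mult.assoc mult.left_commute mult.commute)
      then show ?thesis using mult_right_in[OF IH] by simp
    qed
    moreover have "sym_bracket (p ^ Suc i * ?b ^ (2 * j)) r * ?b \<in> J"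
      by (intro mult_right_in bracket_in IH)
    moreover have "sym_bracket (p ^ Suc i * ?b ^ (2 * j)) r * ?b
        - p ^ Suc i * sym_bracket (?b ^ (2 * j)) r * ?b
        = of_int (int (Suc i)) * (p ^ i * ?b ^ (2 * Suc j))"
      unfolding sym_bracket_mult sym_bracket_power by (simp add: algebra_simps)
    ultimately have "of_int (int (Suc i)) * (p ^ i * ?b ^ (2 * Suc j)) \<in> J"
      using diff_in by metis
    then show ?case unfolding i_def by (rule of_int_cancel) simp
  qed
  from this[of k] show ?thesis by simp
qed

lemma power_mono_in:
  assumes "p ^ k \<in> J" "k \<le> l"
  shows "p ^ l \<in> J"
  using mult_in[OF assms(1), of "p ^ (l - k)"] assms(2) by (simp flip: power_add)

lemma radical_poisson_ideal: "symvir_poisson_ideal radical"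
proof
  show "0 \<in> radical"
    unfolding radical_def using zero_in by (auto intro: exI[of _ 1])
next
  fix p q assume "p \<in> radical" "q \<in> radical"
  then obtain k l where kl: "p ^ k \<in> J" "q ^ l \<in> J" by (auto simp: radical_def)
  have "(p + q) ^ (k + l) \<in> J"
    unfolding binomial_ring
  proof (rule sum_in)
    fix i assume "i \<in> {..k + l}"
    then consider "k \<le> i" | "l \<le> k + l - i" by fastforce
    then show "of_nat (k + l choose i) * p ^ i * q ^ (k + l - i) \<in> J"
      by cases (use kl in \<open>auto intro: mult_in mult_right_in power_mono_in\<close>)
  qed
  then show "p + q \<in> radical" by (auto simp: radical_def)
next
  fix p r assume "p \<in> radical"
  then obtain k where k: "p ^ k \<in> J" by (auto simp: radical_def)
  show "r * p \<in> radical" "sym_bracket p r \<in> radical"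
    using mult_in[OF k, of "r ^ k"] radical_bracket[OF k]
    by (auto simp: radical_def power_mult_distrib)
qed

lemma sum_diff_top_in:
  assumes "finite K" "n \<in> K" "\<And>k. k \<in> K \<Longrightarrow> k \<noteq> n \<Longrightarrow> f k \<in> J"
  shows "sum f K - f n \<in> J"
proof -
  have "sum f K - f n = sum f (K - {n})"
    using assms(1,2) by (simp add: sum.remove)
  then show ?thesis using assms(3) by (auto intro: sum_in)
qed

end

lemma poisson_ideal_S_Vir:
  assumes "poisson_ideal I S_Vir"
  shows "symvir_poisson_ideal I"
proof -
  interpret ideal I S_Vir
    using assms by (simp add: poisson_ideal_def)
  show ?thesis
    using assms additive_subgroup.zero_closed[OF is_additive_subgroup]
      additive_subgroup.a_closed[OF is_additive_subgroup] I_l_closed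
    by unfold_locales (auto simp: poisson_ideal_def S_Vir_def)
qed

section \<open>Brackets with the modes\<close>

text \<open>The shift by one makes the index of a bracket of modes the sum of the two indices.\<close>

definition mode :: "int \<Rightarrow> symvir" where
  "mode i = sym_var (Vec (i + 1))"

abbreviation dmode :: "int \<Rightarrow> symvir \<Rightarrow> symvir" where
  "dmode i \<equiv> sym_pdiff (Vec (i + 1))"

definition cocycle :: "int \<Rightarrow> int \<Rightarrow> int" where
  "cocycle m i = (if m + i = 0 then 2 * (m ^ 3 - m) else 0)"

lemma vir_bracket_modes:
  "sym_incl (vir_bracket (vir_vec (Vec (m + 1))) (vir_vec (Vec (i + 1)))) =
     of_int (i - m) * mode (m + i) + of_int (cocycle m i) * sym_var Central"
proof -
  have incl: "sym_incl (Poly_Mapping.single k (of_int c), of_int d)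
      = of_int c * sym_var (Vec k) + of_int d * sym_var Central" for k c d
    by (cases "c = 0") (simp_all add: sym_incl_def sym_const_of_int sym_const_simps)
  have "vir_bracket (vir_vec (Vec (m + 1))) (vir_vec (Vec (i + 1))) =
      (Poly_Mapping.single (m + i + 1) (of_int (i - m)), of_int (cocycle m i))"
  proof (cases "m + i = 0")
    case True
    then have "i = - m" by simp
    then show ?thesis
      by (simp add: vir_bracket_pair laurent_deriv_single mult_single laurent_res_def
          cocycle_def power3_eq_cube algebra_simps single_diff[symmetric])
  next
    case False
    then show ?thesis
      by (simp add: vir_bracket_pair laurent_deriv_single mult_single laurent_res_def
          lookup_single when_def cocycle_def algebra_simps single_diff[symmetric])
  qed
  then show ?thesis by (simp only: incl mode_def)
qed

definition mode_support :: "symvir \<Rightarrow> int set" where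
  "mode_support p = {i. dmode i p \<noteq> 0}"

lemma mode_support_vars: "i \<in> mode_support p \<Longrightarrow> Vec (i + 1) \<in> sym_vars p"
  using sym_pdiff_not_in_vars by (auto simp: mode_support_def)

lemma finite_mode_support [simp]: "finite (mode_support p)"
proof (rule finite_imageD)
  show "finite ((\<lambda>i. Vec (i + 1)) ` mode_support p)"
    by (rule finite_subset[OF _ finite_sym_vars[of p]]) (auto dest: mode_support_vars)
qed (simp add: inj_on_def)

text \<open>
  For \<open>a\<^sub>i = \<partial>p/\<partial>e\<^sub>i\<close> this is the bracket \<open>{e\<^sub>m, p}\<close>.  The relations below use \<open>p\<close> only
  through its differential, hence the family \<open>a\<close> as the argument.
\<close>

definition mode_action :: "int set \<Rightarrow> (int \<Rightarrow> symvir) \<Rightarrow> int \<Rightarrow> symvir" where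
  "mode_action K a m = (\<Sum>i\<in>K. a i *
     (of_int (i - m) * mode (m + i) + of_int (cocycle m i) * sym_var Central))"

lemma sym_bracket_mode:
  "sym_bracket (mode m) p = mode_action (mode_support p) (\<lambda>i. dmode i p) m"
proof -
  let ?F = "\<lambda>b. sym_pdiff b p * sym_incl (vir_bracket (vir_vec (Vec (m + 1))) (vir_vec b))"
  have "sym_bracket (mode m) p = (\<Sum>b\<in>sym_vars p. ?F b)"
    by (simp add: sym_bracket_def mode_def sym_pdiff_var del: vir_vec.simps)
  also have "\<dots> = (\<Sum>b\<in>(\<lambda>i. Vec (i + 1)) ` mode_support p. ?F b)"
  proof (intro sum.mono_neutral_right ballI)
    fix b assume b: "b \<in> sym_vars p - (\<lambda>i. Vec (i + 1)) ` mode_support p"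
    show "?F b = 0"
    proof (cases b)
      case (Vec n)
      with b have "n - 1 \<notin> mode_support p" by force
      with Vec show ?thesis by (simp add: mode_support_def)
    next
      case Central
      then show ?thesis
        using vir_bracket_anti[of "vir_vec (Vec (m + 1))" "(0, 1)"] by (simp add: vir_bracket_central)
    qed
  qed (auto dest: mode_support_vars)
  also have "\<dots> = (\<Sum>i\<in>mode_support p. ?F (Vec (i + 1)))"
    by (subst sum.reindex) (simp_all add: inj_on_def del: vir_vec.simps)
  finally show ?thesis
    by (simp only: vir_bracket_modes mode_action_def)
qed

lemma dmode_mode: "dmode i (mode k) = (if i = k then 1 else 0)"
  by (auto simp: mode_def sym_pdiff_var)

text \<open>
  Among the modes, only \<open>e\<^sub>i\<close> with \<open>i \<le> N\<close> occur in \<open>p\<close> and its derivatives.  Thus a mode beyond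
  \<open>N\<close> enters \<open>{e\<^sub>s, p} = \<Sum>\<^sub>i \<partial>p/\<partial>e\<^sub>i {e\<^sub>s, e\<^sub>i}\<close> only linearly, through the factors \<open>{e\<^sub>s, e\<^sub>i}\<close>.
\<close>

lemma dmode_bracket_mode:
  assumes top: "\<And>i. i > N \<Longrightarrow> dmode i p = 0" and "s > 0" "k \<ge> s + N"
  shows "dmode k (sym_bracket (mode s) p) = (if k = s + N then of_int (N - s) * dmode N p else 0)"
proof -
  have 1: "dmode k (dmode i p) = 0" for i
    using top[of k] assms(2,3) sym_pdiff_commute[of "Vec (k + 1)" "Vec (i + 1)" p] by simp
  have z: "dmode i (sym_var Central) = 0" for i by (simp add: sym_pdiff_var)
  have "dmode k (sym_bracket (mode s) p)
      = (\<Sum>i\<in>mode_support p. dmode i p * (of_int (i - s) * (if k = s + i then 1 else 0)))"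
    unfolding sym_bracket_mode mode_action_def
    by (simp add: sym_pdiff_sum sym_pdiff_mult sym_pdiff_add 1 z dmode_mode del: of_int_diff)
  also have "\<dots> = (\<Sum>i\<in>mode_support p. if i = k - s then dmode i p * of_int (i - s) else 0)"
    by (intro sum.cong) auto
  also have "\<dots> = dmode (k - s) p * of_int (k - s - s)"
    using finite_mode_support[of p] by (auto simp: sum.delta mode_support_def)
  also have "\<dots> = (if k = s + N then of_int (N - s) * dmode N p else 0)"
    using top[of "k - s"] assms(3) by (auto simp: mult.commute)
  finally show ?thesis .
qed

section \<open>Quadratic and cubic convolution identities\<close>

text \<open>
  If \<open>a\<close> is read as the Laurent polynomial \<open>\<Sum> a\<^sub>i t\<^sup>i\<^sup>+\<^sup>1\<close> and the modes as the coefficients of the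
  generic quadratic differential \<open>\<phi> = \<Sum> e\<^sub>k t\<^sup>-\<^sup>k\<^sup>-\<^sup>2\<close>, this is the coefficient of
  \<open>t\<^sup>-\<^sup>q\<close> in \<open>a\<^sup>2 \<phi>\<close>.
\<close>

definition square_pairing :: "int set \<Rightarrow> (int \<Rightarrow> symvir) \<Rightarrow> int \<Rightarrow> symvir" where
  "square_pairing K a q = (\<Sum>i\<in>K. \<Sum>j\<in>K. a i * a j * mode (q + i + j))"

text \<open>
  The integrated stabiliser equation.  In \<open>\<Sum> a\<^sub>i a\<^sub>j (j - (q + i)) e\<^sub>q\<^sub>+\<^sub>i\<^sub>+\<^sub>j\<close> the antisymmetric weight
  \<open>j - i\<close> cancels and only \<open>- q\<close> survives, which is the derivative of \<open>a\<^sup>2 \<phi>\<close>.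
\<close>

lemma mode_action_square:
  "(\<Sum>j\<in>K. a j * mode_action K a (q + j)) =
     - of_int q * square_pairing K a q
     + (\<Sum>i\<in>K. \<Sum>j\<in>K. a i * a j * of_int (cocycle (q + i) j)) * sym_var Central"
proof -
  define F where "F i j = a i * a j * mode (q + i + j)" for i j
  have "(\<Sum>j\<in>K. \<Sum>i\<in>K. of_int i * F j i) = (\<Sum>j\<in>K. \<Sum>i\<in>K. of_int j * F j i)"
    by (subst sum.swap) (simp add: F_def ac_simps)
  moreover have "a j * mode_action K a (q + j) = (\<Sum>i\<in>K. of_int i * F j i)
      - (\<Sum>i\<in>K. of_int j * F j i) - of_int q * (\<Sum>i\<in>K. F j i)
      + (\<Sum>i\<in>K. a j * a i * of_int (cocycle (q + j) i)) * sym_var Central" for j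
    unfolding mode_action_def F_def sum_distrib_left sum_distrib_right
      sum.distrib[symmetric] sum_subtractf[symmetric]
    by (intro sum.cong) (simp_all add: algebra_simps)
  ultimately show ?thesis
    by (simp add: sum.distrib sum_subtractf square_pairing_def F_def[symmetric]
        flip: sum_distrib_left sum_distrib_right)
qed

text \<open>
  The remaining factor is symmetric in the three indices, so the weight \<open>l + i + j\<close> may be replaced
  by \<open>3 l\<close>.  This leaves the sum over \<open>i\<close> and \<open>j\<close> unweighted, hence a value of
  \<open>square_pairing\<close>.
\<close>

lemma sum_symmetric_weight:
  fixes a :: "int \<Rightarrow> symvir"
  shows "(\<Sum>l\<in>K. \<Sum>i\<in>K. \<Sum>j\<in>K. a l * a i * a j * (of_int (c - (l + i + j)) * mode (p + l + i + j)))
     = (\<Sum>l\<in>K. a l * (of_int (c - 3 * l) * square_pairing K a (p + l)))"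
proof -
  define F where "F l i j = a l * a i * a j * mode (p + l + i + j)" for l i j
  have 1: "(\<Sum>l\<in>K. \<Sum>i\<in>K. \<Sum>j\<in>K. of_int i * F l i j) = (\<Sum>l\<in>K. \<Sum>i\<in>K. \<Sum>j\<in>K. of_int l * F l i j)"
    by (subst sum.swap) (simp add: F_def ac_simps)
  have "(\<Sum>i\<in>K. \<Sum>j\<in>K. of_int j * F l i j) = (\<Sum>i\<in>K. \<Sum>j\<in>K. of_int i * F l i j)" for l
    by (subst sum.swap) (simp add: F_def ac_simps)
  then have 2: "(\<Sum>l\<in>K. \<Sum>i\<in>K. \<Sum>j\<in>K. of_int j * F l i j)
      = (\<Sum>l\<in>K. \<Sum>i\<in>K. \<Sum>j\<in>K. of_int l * F l i j)"
    using 1 by simp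
  have "(\<Sum>l\<in>K. \<Sum>i\<in>K. \<Sum>j\<in>K. a l * a i * a j * (of_int (c - (l + i + j)) * mode (p + l + i + j)))
     = (\<Sum>l\<in>K. \<Sum>i\<in>K. \<Sum>j\<in>K. of_int c * F l i j - of_int l * F l i j - of_int i * F l i j
          - of_int j * F l i j)"
    by (simp add: F_def algebra_simps)
  also have "\<dots> = (\<Sum>l\<in>K. \<Sum>i\<in>K. \<Sum>j\<in>K. of_int c * F l i j - of_int (3 * l) * F l i j)"
    using 1 2 by (simp add: sum_subtractf mult.assoc flip: sum_distrib_left)
  also have "\<dots> = (\<Sum>l\<in>K. a l * (of_int (c - 3 * l) * square_pairing K a (p + l)))"
    unfolding square_pairing_def sum_distrib_left
    by (intro sum.cong) (simp_all add: F_def algebra_simps)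
  finally show ?thesis .
qed

text \<open>
  The product of \<open>a\<^sup>3\<close> with the stabiliser equation of \<open>b\<close>: apart from the central term, the modes
  enter only through \<open>a\<^sup>2 \<phi>\<close>, whose coefficients at \<open>q \<noteq> 0\<close> are determined modulo the ideal
  by \<open>mode_action_square\<close>.
\<close>

lemma mode_action_cube:
  "(\<Sum>l\<in>K. \<Sum>i\<in>K. \<Sum>j\<in>K. a l * a i * a j * mode_action L b (m + l + i + j)) =
     (\<Sum>k\<in>L. \<Sum>l\<in>K. b k * (a l * (of_int (k - m - 3 * l) * square_pairing K a (m + k + l))))
     + (\<Sum>k\<in>L. \<Sum>l\<in>K. \<Sum>i\<in>K. \<Sum>j\<in>K.
          b k * a l * a i * a j * of_int (cocycle (m + l + i + j) k)) * sym_var Central"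
proof -
  have out: "(\<Sum>l\<in>K. \<Sum>i\<in>K. \<Sum>j\<in>K. \<Sum>k\<in>L. G k l i j)
      = (\<Sum>k\<in>L. \<Sum>l\<in>K. \<Sum>i\<in>K. \<Sum>j\<in>K. G k l i j)" for G :: "int \<Rightarrow> int \<Rightarrow> int \<Rightarrow> int \<Rightarrow> symvir"
    by (simp only: sum.swap[of _ L K])
  have "(\<Sum>l\<in>K. \<Sum>i\<in>K. \<Sum>j\<in>K. a l * a i * a j * mode_action L b (m + l + i + j)) =
     (\<Sum>k\<in>L. \<Sum>l\<in>K. \<Sum>i\<in>K. \<Sum>j\<in>K.
        b k * (a l * a i * a j * (of_int (k - m - (l + i + j)) * mode (m + k + l + i + j)))
        + b k * a l * a i * a j * of_int (cocycle (m + l + i + j) k) * sym_var Central)"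
    unfolding mode_action_def sum_distrib_left out
    by (intro sum.cong) (simp_all add: algebra_simps)
  also have "\<dots> = (\<Sum>k\<in>L. b k * (\<Sum>l\<in>K. \<Sum>i\<in>K. \<Sum>j\<in>K.
        a l * a i * a j * (of_int (k - m - (l + i + j)) * mode (m + k + l + i + j))))
     + (\<Sum>k\<in>L. \<Sum>l\<in>K. \<Sum>i\<in>K. \<Sum>j\<in>K.
          b k * a l * a i * a j * of_int (cocycle (m + l + i + j) k)) * sym_var Central"
    by (simp add: sum.distrib sum_distrib_left sum_distrib_right)
  finally show ?thesis
    unfolding sum_symmetric_weight sum_distrib_left .
qed

lemma sum_eq_term:
  assumes "finite K" "n \<in> K" "\<And>k. k \<in> K \<Longrightarrow> k \<noteq> n \<Longrightarrow> f k = 0"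
  shows "sum f K = f n"
  using assms by (simp add: sum.remove)

context symvir_poisson_ideal
begin

text \<open>
  Below \<open>- 2 N\<close> the central term of \<open>mode_action_square\<close> vanishes, because \<open>i + j \<le> 2 N\<close>; at
  \<open>- 2 N\<close> only \<open>i = j = N\<close> contributes to it.
\<close>

lemma square_pairing_in:
  assumes K: "finite K" "\<And>i. i \<in> K \<Longrightarrow> i \<le> N" and a: "\<And>m. mode_action K a m \<in> J"
    and "N > 0" "q < - 2 * N"
  shows "square_pairing K a q \<in> J"
proof -
  have "(\<Sum>i\<in>K. \<Sum>j\<in>K. a i * a j * of_int (cocycle (q + i) j)) = 0"
  proof (intro sum.neutral ballI)
    fix i j assume "i \<in> K" "j \<in> K"
    then have "q + i + j < 0" using K(2)[of i] K(2)[of j] assms(5) by linarith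
    then show "a i * a j * of_int (cocycle (q + i) j) = 0" by (simp add: cocycle_def)
  qed
  moreover have "(\<Sum>j\<in>K. a j * mode_action K a (q + j)) \<in> J"
    by (intro sum_in mult_in a)
  ultimately have "of_int (- q) * square_pairing K a q \<in> J"
    by (simp add: mode_action_square)
  then show ?thesis by (rule of_int_cancel) (use assms(4,5) in simp)
qed

lemma square_pairing_top_in:
  assumes K: "finite K" "N \<in> K" "\<And>i. i \<in> K \<Longrightarrow> i \<le> N" and a: "\<And>m. mode_action K a m \<in> J"
    and "N > 0"
  shows "square_pairing K a (- 2 * N) - of_int (N ^ 2 - 1) * (a N ^ 2 * sym_var Central) \<in> J"
proof -
  let ?q = "- 2 * N"
  have c0: "cocycle (?q + i) j = 0" if "i \<in> K" "j \<in> K" "i \<noteq> N \<or> j \<noteq> N" for i j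
    using K(3)[OF that(1)] K(3)[OF that(2)] that(3) by (auto simp: cocycle_def)
  have "(\<Sum>i\<in>K. \<Sum>j\<in>K. a i * a j * of_int (cocycle (?q + i) j))
     = (\<Sum>j\<in>K. a N * a j * of_int (cocycle (?q + N) j))"
    by (rule sum_eq_term[OF K(1,2)], intro sum.neutral ballI, subst c0) auto
  also have "\<dots> = a N * a N * of_int (cocycle (?q + N) N)"
    by (rule sum_eq_term[OF K(1,2)], subst c0) (auto simp: K)
  also have "\<dots> = a N ^ 2 * of_int (2 * (N - N ^ 3))"
    by (simp add: cocycle_def power2_eq_square power3_eq_cube)
  finally have c: "(\<Sum>i\<in>K. \<Sum>j\<in>K. a i * a j * of_int (cocycle (?q + i) j))
      = a N ^ 2 * of_int (2 * (N - N ^ 3))" .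
  have "(\<Sum>j\<in>K. a j * mode_action K a (?q + j)) \<in> J"
    by (intro sum_in mult_in a)
  also have "(\<Sum>j\<in>K. a j * mode_action K a (?q + j)) =
      of_int (2 * N) * (square_pairing K a ?q - of_int (N ^ 2 - 1) * (a N ^ 2 * sym_var Central))"
    unfolding mode_action_square c by (simp add: algebra_simps power2_eq_square power3_eq_cube)
  finally show ?thesis by (rule of_int_cancel) (use assms(5) in simp)
qed

text \<open>
  The index \<open>m = - n - 3 N\<close> makes all \<open>square_pairing\<close> terms of \<open>mode_action_cube\<close> lie below
  \<open>- 2 N\<close> except the one with \<open>k = n\<close>, \<open>l = N\<close>, and reduces the central sum to a single
  term.  Up to the factor \<open>z a\<^sub>N\<^sup>3 b\<^sub>n\<close>, these two exceptional terms contribute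
  \<open>2 n (N\<^sup>2 - 1)\<close> and \<open>2 (n - n\<^sup>3)\<close>, with sum \<open>2 n (N\<^sup>2 - n\<^sup>2) \<noteq> 0\<close>.
\<close>

lemma top_derivatives_product_in:
  assumes K: "finite K" "N \<in> K" "\<And>i. i \<in> K \<Longrightarrow> i \<le> N" and a: "\<And>m. mode_action K a m \<in> J"
    and L: "finite L" "n \<in> L" "\<And>i. i \<in> L \<Longrightarrow> i \<le> n" and b: "\<And>m. mode_action L b m \<in> J"
    and N: "0 < N" "N < n"
  shows "sym_var Central * a N ^ 3 * b n \<in> J"
proof -
  let ?z = "sym_var Central"
  define m where "m = - n - 3 * N"
  define t where "t k l = b k * (a l * (of_int (k - m - 3 * l) * square_pairing K a (m + k + l)))" for k l
  have t: "t k l \<in> J" if "k \<in> L" "l \<in> K" "k \<noteq> n \<or> l \<noteq> N" for k l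
  proof -
    have "m + k + l < - 2 * N"
      using L(3)[OF that(1)] K(3)[OF that(2)] that(3) by (auto simp: m_def)
    then show ?thesis
      unfolding t_def by (intro mult_in square_pairing_in[OF K(1) K(3) a N(1)])
  qed
  have "(\<Sum>k\<in>L. \<Sum>l\<in>K. t k l) - (\<Sum>l\<in>K. t n l) \<in> J"
    by (rule sum_diff_top_in[OF L(1,2)]) (auto intro: sum_in t)
  moreover have "(\<Sum>l\<in>K. t n l) - t n N \<in> J"
    by (rule sum_diff_top_in[OF K(1,2)]) (auto intro: t L)
  ultimately have T: "(\<Sum>k\<in>L. \<Sum>l\<in>K. t k l) - t n N \<in> J"
    using add_in by fastforce
  have c0: "cocycle (m + l + i + j) k = 0"
    if "k \<in> L" "l \<in> K" "i \<in> K" "j \<in> K" "k \<noteq> n \<or> l \<noteq> N \<or> i \<noteq> N \<or> j \<noteq> N" for k l i j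
    using L(3)[OF that(1)] K(3)[OF that(2)] K(3)[OF that(3)] K(3)[OF that(4)] that(5)
    by (auto simp: cocycle_def m_def)
  have c1: "cocycle (m + N + N + N) n = 2 * (n - n ^ 3)"
    by (simp add: cocycle_def m_def power3_eq_cube)
  have "(\<Sum>k\<in>L. \<Sum>l\<in>K. \<Sum>i\<in>K. \<Sum>j\<in>K. b k * a l * a i * a j * of_int (cocycle (m + l + i + j) k))
     = (\<Sum>l\<in>K. \<Sum>i\<in>K. \<Sum>j\<in>K. b n * a l * a i * a j * of_int (cocycle (m + l + i + j) n))"
    by (rule sum_eq_term[OF L(1,2)], intro sum.neutral ballI, subst c0) auto
  also have "\<dots> = (\<Sum>i\<in>K. \<Sum>j\<in>K. b n * a N * a i * a j * of_int (cocycle (m + N + i + j) n))"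
    by (rule sum_eq_term[OF K(1,2)], intro sum.neutral ballI, subst c0) (auto simp: L)
  also have "\<dots> = (\<Sum>j\<in>K. b n * a N * a N * a j * of_int (cocycle (m + N + N + j) n))"
    by (rule sum_eq_term[OF K(1,2)], intro sum.neutral ballI, subst c0) (auto simp: L K)
  also have "\<dots> = b n * a N * a N * a N * of_int (cocycle (m + N + N + N) n)"
    by (rule sum_eq_term[OF K(1,2)], subst c0) (auto simp: L K)
  also have "\<dots> = b n * a N ^ 3 * of_int (2 * (n - n ^ 3))"
    unfolding c1 by (simp add: power3_eq_cube mult.assoc)
  finally have c: "(\<Sum>k\<in>L. \<Sum>l\<in>K. \<Sum>i\<in>K. \<Sum>j\<in>K.
      b k * a l * a i * a j * of_int (cocycle (m + l + i + j) k))
      = b n * a N ^ 3 * of_int (2 * (n - n ^ 3))" .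
  have "(\<Sum>l\<in>K. \<Sum>i\<in>K. \<Sum>j\<in>K. a l * a i * a j * mode_action L b (m + l + i + j)) \<in> J"
    by (intro sum_in mult_in b)
  then have "(\<Sum>k\<in>L. \<Sum>l\<in>K. t k l) + b n * a N ^ 3 * of_int (2 * (n - n ^ 3)) * ?z \<in> J"
    unfolding mode_action_cube c t_def .
  from diff_in[OF this T]
  have 1: "t n N + b n * a N ^ 3 * of_int (2 * (n - n ^ 3)) * ?z \<in> J"
    by (simp add: add.commute)
  have tn: "t n N = of_int (2 * n) * (b n * a N * square_pairing K a (- 2 * N))"
    by (simp add: t_def m_def ac_simps)
  have 2: "of_int (2 * n) * (b n * a N) *
      (square_pairing K a (- 2 * N) - of_int (N ^ 2 - 1) * (a N ^ 2 * ?z)) \<in> J"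
    by (intro mult_in square_pairing_top_in[OF K a N(1)])
  have "of_int (2 * n * (N ^ 2 - n ^ 2)) * (?z * a N ^ 3 * b n) \<in> J"
    using diff_in[OF 1 2] unfolding tn
    by (simp add: algebra_simps power2_eq_square power3_eq_cube)
  moreover have "N ^ 2 < n ^ 2"
    using N by (intro power_strict_mono) auto
  then have "2 * n * (N ^ 2 - n ^ 2) \<noteq> 0"
    using N by simp
  ultimately show ?thesis by (rule of_int_cancel)
qed

text \<open>
  Two brackets with modes give elements \<open>f\<close> and \<open>g\<close> of \<open>J\<close> whose top derivatives are nonzero integer
  multiples of that of \<open>p\<close>.  The first bracket makes the top index positive, the second one makes
  it larger.
\<close>

lemma top_derivative_in:
  assumes "p \<in> J" and top: "\<And>i. i > N \<Longrightarrow> dmode i p = 0"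
  shows "sym_var Central * dmode N p ^ 4 \<in> J"
proof (cases "dmode N p = 0")
  case True
  then show ?thesis by (simp add: zero_in)
next
  case False
  \<comment> \<open>This \<open>s\<close> makes \<open>s + N\<close> positive and the factor \<open>N - s\<close> of the new top derivative nonzero;
    for the second bracket, with index \<open>M + 1\<close>, the factor is \<open>M - (M + 1) = - 1\<close>.\<close>
  define s where "s = \<bar>N\<bar> + 1"
  define f where "f = sym_bracket (mode s) p"
  define M where "M = s + N"
  define g where "g = sym_bracket (mode (M + 1)) f"
  define n where "n = M + 1 + M"
  have s: "s > 0" "M > 0" "N - s \<noteq> 0" by (auto simp: s_def M_def)
  have f: "dmode k f = (if k = M then of_int (N - s) * dmode N p else 0)" if "k \<ge> M" for k
    using that s dmode_bracket_mode[OF top, of N s k] by (simp add: f_def M_def)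
  have g: "dmode k g = (if k = n then - dmode M f else 0)" if "k \<ge> n" for k
    using that s f dmode_bracket_mode[of M f "M + 1" k] by (simp add: g_def n_def)
  have nz: "dmode M f \<noteq> 0"
  proof
    assume "dmode M f = 0"
    then have "sym_const (of_int (N - s)) * dmode N p = 0" by (simp add: f sym_const_of_int del: of_int_diff)
    then have "sym_const (inverse (of_int (N - s))) * (sym_const (of_int (N - s)) * dmode N p) = 0" by simp
    then show False
      using False s(3) by (simp add: sym_const_simps flip: mult.assoc sym_const_simps(4) del: of_int_diff)
  qed
  have supp: "M \<in> mode_support f" "n \<in> mode_support g"
    using nz g[of n] by (auto simp: mode_support_def)
  have J: "f \<in> J" "g \<in> J" using assms(1) by (auto simp: f_def g_def intro: bracket_left_in)
  have act: "mode_action (mode_support h) (\<lambda>i. dmode i h) m \<in> J" if "h \<in> J" for h m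
    unfolding sym_bracket_mode[symmetric] by (rule bracket_left_in[OF that])
  have "sym_var Central * dmode M f ^ 3 * dmode n g \<in> J"
  proof (rule top_derivatives_product_in[of "mode_support f" M "\<lambda>i. dmode i f"
        "mode_support g" n "\<lambda>i. dmode i g"])
    show "i \<le> M" if "i \<in> mode_support f" for i
      using that f[of i] by (intro leI notI) (simp add: mode_support_def)
    show "i \<le> n" if "i \<in> mode_support g" for i
      using that g[of i] by (intro leI notI) (simp add: mode_support_def)
  qed (use supp s J act in \<open>auto simp: n_def\<close>)
  also have "sym_var Central * dmode M f ^ 3 * dmode n g
      = of_int (- ((N - s) ^ 4)) * (sym_var Central * dmode N p ^ 4)"
    using f[of M] g[of n] by (simp add: eval_nat_numeral mult.assoc mult.left_commute del: of_int_diff)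
  finally show ?thesis by (rule of_int_cancel) (use s in simp)
qed

section \<open>Descent to a nonzero constant\<close>

text \<open>
  The derivative with respect to the last mode is nonzero, has smaller degree and stays in the
  ideal.  As \<open>z\<close> does not occur in \<open>p\<close>, the descent can only stop at a constant.
\<close>

lemma one_in_radical_ideal:
  assumes rad: "\<And>x k. x ^ k \<in> J \<Longrightarrow> x \<in> J"
    and z: "sym_var Central - sym_const \<zeta> \<in> J" and "\<zeta> \<noteq> 0"
    and "p \<in> J" "p \<noteq> 0" "sym_pdiff Central p = 0" "degree_le d p"
  shows "1 \<in> J"
  using assms(4-7)
proof (induction d arbitrary: p rule: less_induct)
  case (less d)
  show ?case
  proof (cases "mode_support p = {}")
    case True
    have "sym_pdiff b p = 0" for b
    proof (cases b)
      case (Vec n)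
      with True show ?thesis by (auto simp: mode_support_def dest: spec[of _ "n - 1"])
    qed (use less.prems in simp)
    then have c: "p = sym_const (Poly_Mapping.lookup p 0)"
      by (rule pdiff_zero_imp_const)
    have "Poly_Mapping.lookup p 0 \<noteq> 0"
      using c less.prems(2) by (metis sym_const_simps(1))
    then show ?thesis
      using const_cancel[of "Poly_Mapping.lookup p 0" 1] c less.prems(1) by simp
  next
    case False
    define N where "N = Max (mode_support p)"
    let ?u = "dmode N p"
    have nz: "?u \<noteq> 0"
      using Max_in[OF finite_mode_support False] by (simp add: N_def mode_support_def)
    have "dmode i p = 0" if "i > N" for i
      using Max_ge[OF finite_mode_support[of p], of i] that by (auto simp: N_def mode_support_def)
    then have "sym_var Central * ?u ^ 4 \<in> J"
      by (rule top_derivative_in[OF less.prems(1)])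
    from diff_in[OF this mult_right_in[OF z, of "?u ^ 4"]]
    have "sym_const \<zeta> * ?u ^ 4 \<in> J"
      by (simp add: left_diff_distrib)
    then have u: "?u \<in> J"
      using rad const_cancel \<open>\<zeta> \<noteq> 0\<close> by blast
    have lt: "\<And>m. m \<in> Poly_Mapping.keys ?u \<Longrightarrow> monomial_degree m < d"
      using monomial_degree_pdiff_less less.prems(4) by blast
    obtain m where "m \<in> Poly_Mapping.keys ?u" using nz by fastforce
    with lt have "d > 0" by fastforce
    with lt have "degree_le (d - 1) ?u" by (fastforce simp: degree_le_def)
    moreover have "sym_pdiff Central ?u = 0"
      by (subst sym_pdiff_commute) (simp add: less.prems(3))
    ultimately show ?thesis
      using less.IH[of "d - 1" ?u] \<open>d > 0\<close> u nz by simp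
  qed
qed

lemma one_in_if_central_free:
  assumes z: "sym_var Central - sym_const \<zeta> \<in> J" and "\<zeta> \<noteq> 0"
    and p: "p \<in> J" "p \<noteq> 0" "sym_pdiff Central p = 0"
  shows "1 \<in> J"
proof -
  interpret R: symvir_poisson_ideal radical
    by (rule radical_poisson_ideal)
  have sub: "x \<in> radical" if "x \<in> J" for x
    using that by (auto simp: radical_def intro: exI[of _ 1])
  obtain d where "degree_le d p" using degree_le_exists by blast
  then have "1 \<in> radical"
    using R.one_in_radical_ideal[of \<zeta> p d] assms sub
    by (auto simp: radical_def simp flip: power_mult)
  then show ?thesis by (simp add: radical_def)
qed

lemma eliminate_central:
  assumes z: "sym_var Central - sym_const \<zeta> \<in> J"
  shows "\<exists>q. sym_pdiff Central q = 0 \<and> p - q \<in> J"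
proof (induction p rule: sym_induct)
  case (const a)
  show ?case by (rule exI[of _ "sym_const a"]) (simp add: zero_in)
next
  case (var b)
  show ?case
  proof (cases b)
    case (Vec n)
    then show ?thesis by (intro exI[of _ "sym_var b"]) (simp add: zero_in sym_pdiff_var)
  next
    case Central
    then show ?thesis using z by (intro exI[of _ "sym_const \<zeta>"]) simp
  qed
next
  case (add p q)
  then obtain p' q' where "sym_pdiff Central p' = 0" "p - p' \<in> J" "sym_pdiff Central q' = 0" "q - q' \<in> J"
    by blast
  moreover from this have "(p + q) - (p' + q') \<in> J"
    using add_in[of "p - p'" "q - q'"] by (simp add: algebra_simps)
  ultimately show ?case by (intro exI[of _ "p' + q'"]) (simp add: sym_pdiff_add)
next
  case (mult p q)
  then obtain p' q' where h: "sym_pdiff Central p' = 0" "p - p' \<in> J" "sym_pdiff Central q' = 0" "q - q' \<in> J"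
    by blast
  have "p * q - p' * q' \<in> J"
    using add_in[OF mult_right_in[OF h(2), of q] mult_in[OF h(4), of p']] by (simp add: algebra_simps)
  with h show ?case by (intro exI[of _ "p' * q'"]) (simp add: sym_pdiff_mult)
qed

end

section \<open>Poisson ideals of the quotient\<close>

theorem corollary1p3:
  fixes \<zeta> :: complex
  assumes "\<zeta> \<noteq> 0"
  shows "poisson_simple (poisson_quot S_Vir (central_ideal \<zeta>))"
  unfolding poisson_simple_def
proof (intro allI impI)
  let ?C = "central_ideal \<zeta>"
  let ?Q = "poisson_quot S_Vir ?C"
  fix I assume "poisson_ideal I ?Q"
  then have I: "ideal I ?Q" and IB: "\<And>U V. U \<in> I \<Longrightarrow> V \<in> carrier ?Q \<Longrightarrow> pbracket ?Q U V \<in> I"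
    by (auto simp: poisson_ideal_def)
  interpret S: poisson_algebra ring_of_type_algebra S_Vir
    by (rule symvir_poisson_algebra)
  have C: "ideal ?C S_Vir"
    using central_ideal_poisson by (simp add: poisson_ideal_def)
  interpret C: ideal ?C S_Vir by (rule C)
  interpret CJ: symvir_poisson_ideal ?C
    by (rule poisson_ideal_S_Vir) (rule central_ideal_poisson)
  interpret I: ideal I ?Q by (rule I)
  note I_zero = additive_subgroup.zero_closed[OF I.is_additive_subgroup]
    and I_add = additive_subgroup.a_closed[OF I.is_additive_subgroup]
  have UN [simp]: "carrier S_Vir = UNIV" by (simp add: S_Vir_def)
  define cos where "cos p = ?C +>\<^bsub>S_Vir\<^esub> p" for p
  have car: "carrier ?Q = range cos"
    by (auto simp: poisson_quot_def FactRing_def A_RCOSETS_def' cos_def)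
  have ops: "cos p \<oplus>\<^bsub>?Q\<^esub> cos q = cos (p + q)" "cos p \<otimes>\<^bsub>?Q\<^esub> cos q = cos (p * q)"
     "pbracket ?Q (cos p) (cos q) = cos (sym_bracket p q)" for p q
    using C.a_rcos_sum[of p q] C.rcoset_mult_add[of p q] S.quot_pbracket[OF central_ideal_poisson, of p q]
    by (simp_all add: cos_def poisson_quot_def FactRing_def) (simp_all add: S_Vir_def)
  have zero: "\<zero>\<^bsub>?Q\<^esub> = ?C"
    by (simp add: poisson_quot_def FactRing_def)
  have cos_zero: "cos p = \<zero>\<^bsub>?Q\<^esub> \<longleftrightarrow> p \<in> ?C" for p
    using S.coset_self[OF C, of p] C.a_rcos_const[of p] by (auto simp: cos_def zero)
  define J where "J = {p. cos p \<in> I}"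
  interpret J: symvir_poisson_ideal J
  proof
    show "0 \<in> J"
      using cos_zero[of 0] I_zero CJ.zero_in by (simp add: J_def S_Vir_def)
  next
    fix p q assume "p \<in> J" "q \<in> J"
    then show "p + q \<in> J"
      using I_add[of "cos p" "cos q"] by (simp add: J_def ops)
  next
    fix p r assume p: "p \<in> J"
    show "r * p \<in> J"
      using p I.I_l_closed[of "cos p" "cos r"] by (simp add: J_def ops car)
    show "sym_bracket p r \<in> J"
      using p IB[of "cos p" "cos r"] by (simp add: J_def ops car)
  qed
  have C_J: "p \<in> ?C \<Longrightarrow> p \<in> J" for p
    using cos_zero[of p] I_zero by (simp add: J_def)
  have z: "sym_var Central - sym_const \<zeta> \<in> ?C"
    using ring.genideal_self'[OF cring.axioms(1)[OF symvir_cring], of "sym_incl (0, 1) - sym_const \<zeta>"]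
      sym_incl_vec[of Central]
    by (simp add: central_ideal_def)
  show "I = {\<zero>\<^bsub>?Q\<^esub>} \<or> I = carrier ?Q"
  proof (cases "J \<subseteq> ?C")
    case True
    have "U = \<zero>\<^bsub>?Q\<^esub>" if "U \<in> I" for U
    proof -
      obtain p where "U = cos p"
        using I.a_subset \<open>U \<in> I\<close> car by blast
      with that True show ?thesis by (auto simp: cos_zero J_def)
    qed
    then show ?thesis using I_zero by blast
  next
    case False
    then obtain p where p: "p \<in> J" "p \<notin> ?C" by blast
    obtain q where q: "sym_pdiff Central q = 0" "p - q \<in> ?C"
      using CJ.eliminate_central[OF z] by blast
    have "q \<in> J"
      using J.diff_in[OF p(1) C_J[OF q(2)]] by simp
    moreover have "q \<noteq> 0" using q(2) p(2) by auto
    ultimately have "1 \<in> J"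
      using J.one_in_if_central_free[OF C_J[OF z] assms] q(1) by blast
    then have "p \<in> J" for p
      using J.mult_in[of 1 p] by simp
    then have "carrier ?Q \<subseteq> I"
      unfolding car J_def by blast
    with I.a_subset show ?thesis by blast
  qed
qed

end
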